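(* There is a finite presentation $P=\langle X\mid R\rangle$ of a group with solvable word problem (namely, the Baumslag--Solitar presentation $P=\mathrm{BS}(2,3)=\langle s,t\mid s^{-1}t^{2}s=t^{3}\rangle$) for which there is no partial algorithm that, on input of a recursive presentation $Q=\langle Y\mid S\rangle$ such that $\overline{P}\cong\overline{Q}$, outputs a set map $\phi:X\to Y^{*}$ which extends to an isomorphism $\overline{\phi}:\overline{P}\to\overline{Q}$.
   Context: Notation: for a group presentation $P=\langle X\mid R\rangle$, $\overline{P}$ denotes the group presented by $P$. $Y^{*}$ denotes the set of finite words on $Y\cup Y^{-1}$, including the empty word. A presentation $\langle Y\mid S\rangle$ is a recursive presentation if $Y$ is a finite set and $S$ is a recursive enumeration of relators (words in $Y^{*}$); such a presentation is given as input to an algorithm by $Y$ together with a description of a machine enumerating $S$. A partial algorithm on inputs satisfying a condition is required to halt with correct output on all inputs satisfying the condition, with nothing required on other inputs. *)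

theory Defs
  imports "HOL-Algebra.Group" "HOL-Library.Nat_Bijection"
begin

section \<open>Words and group presentations\<close>

datatype 'a letter = Gen 'a | Inv 'a

type_synonym 'a word = "'a letter list"

primrec letter_gen :: "'a letter \<Rightarrow> 'a" where
  "letter_gen (Gen x) = x"
| "letter_gen (Inv x) = x"

primrec letter_inv :: "'a letter \<Rightarrow> 'a letter" where
  "letter_inv (Gen x) = Inv x"
| "letter_inv (Inv x) = Gen x"

definition word_inv :: "'a word \<Rightarrow> 'a word" where
  "word_inv w = rev (map letter_inv w)"

definition words :: "'a set \<Rightarrow> 'a word set" where
  "words X = {w. letter_gen ` set w \<subseteq> X}"

datatype 'a presentation = Presentation (gens: "'a set") (rels: "'a word set")

definition wf_presentation :: "'a presentation \<Rightarrow> bool" where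
  "wf_presentation P \<longleftrightarrow> rels P \<subseteq> words (gens P)"

definition finite_presentation :: "'a presentation \<Rightarrow> bool" where
  "finite_presentation P \<longleftrightarrow> wf_presentation P \<and> finite (gens P) \<and> finite (rels P)"

text \<open>The congruence on words generated by free cancellation and by deleting relators; its
  classes are the elements of the presented group.\<close>

inductive word_eq :: "'a presentation \<Rightarrow> 'a word \<Rightarrow> 'a word \<Rightarrow> bool" for P where
  refl: "w \<in> words (gens P) \<Longrightarrow> word_eq P w w"
| sym: "word_eq P u v \<Longrightarrow> word_eq P v u"
| trans: "word_eq P u v \<Longrightarrow> word_eq P v w \<Longrightarrow> word_eq P u w"
| cancel: "\<lbrakk>u \<in> words (gens P); v \<in> words (gens P); letter_gen l \<in> gens P\<rbrakk>
    \<Longrightarrow> word_eq P (u @ [l, letter_inv l] @ v) (u @ v)"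
| relator: "\<lbrakk>u \<in> words (gens P); v \<in> words (gens P); r \<in> rels P\<rbrakk>
    \<Longrightarrow> word_eq P (u @ r @ v) (u @ v)"

definition word_class :: "'a presentation \<Rightarrow> 'a word \<Rightarrow> 'a word set" where
  "word_class P w = {v. word_eq P w v}"

definition presented_group :: "'a presentation \<Rightarrow> 'a word set monoid" where
  "presented_group P =
     \<lparr>carrier = word_class P ` words (gens P),
      mult = (\<lambda>A B. \<Union>u\<in>A. \<Union>v\<in>B. word_class P (u @ v)),
      one = word_class P []\<rparr>"

text \<open>A set map \<open>\<phi>\<close> from the generators of \<open>P\<close> to words on the generators of \<open>Q\<close> extends to
  an isomorphism of the presented groups.\<close>

definition extends_to_iso :: "'a presentation \<Rightarrow> 'b presentation \<Rightarrow> ('a \<Rightarrow> 'b word) \<Rightarrow> bool" where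
  "extends_to_iso P Q \<phi> \<longleftrightarrow>
     (\<exists>h \<in> iso (presented_group P) (presented_group Q).
        \<forall>x \<in> gens P. h (word_class P [Gen x]) = word_class Q (\<phi> x))"

text \<open>\<open>\<langle>s, t | s\<^sup>-\<^sup>1 t\<^sup>m s = t\<^sup>n\<rangle>\<close>, with the generators \<open>s\<close> and \<open>t\<close> named
  \<open>0\<close> and \<open>1\<close>; a relation \<open>u = v\<close> stands for the relator \<open>u v\<^sup>-\<^sup>1\<close>.\<close>

definition BS :: "nat \<Rightarrow> nat \<Rightarrow> nat presentation" where
  "BS m n = (let s = 0; t = 1 in
     Presentation {s, t}
       {([Inv s] @ replicate m (Gen t) @ [Gen s]) @ word_inv (replicate n (Gen t))})"


section \<open>Partial recursive functions\<close>

text \<open>Programs for the unary partial recursive functions on the natural numbers; several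
  arguments are passed through the pairing \<^const>\<open>prod_encode\<close>.  The identity is
  \<open>PairF Proj1 Proj2\<close>.\<close>

datatype recf =
    Zero
  | Succ
  | Proj1
  | Proj2
  | PairF recf recf
  | Comp recf recf
  | PrimRec recf recf
  | Mu recf

text \<open>\<open>evals f n m\<close>: the program \<open>f\<close> halts on input \<open>n\<close> with output \<open>m\<close>.\<close>

inductive evals :: "recf \<Rightarrow> nat \<Rightarrow> nat \<Rightarrow> bool" where
  Zero: "evals Zero n 0"
| Succ: "evals Succ n (Suc n)"
| Proj1: "evals Proj1 (prod_encode (a, b)) a"
| Proj2: "evals Proj2 (prod_encode (a, b)) b"
| PairF: "evals f n a \<Longrightarrow> evals g n b \<Longrightarrow> evals (PairF f g) n (prod_encode (a, b))"
| Comp: "evals g n m \<Longrightarrow> evals f m k \<Longrightarrow> evals (Comp f g) n k"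
| PrimRec_0: "evals f a k \<Longrightarrow> evals (PrimRec f g) (prod_encode (a, 0)) k"
| PrimRec_Suc: "evals (PrimRec f g) (prod_encode (a, n)) m
    \<Longrightarrow> evals g (prod_encode (a, prod_encode (n, m))) k
    \<Longrightarrow> evals (PrimRec f g) (prod_encode (a, Suc n)) k"
| Mu: "evals f (prod_encode (n, m)) 0
    \<Longrightarrow> \<forall>i<m. \<exists>k. evals f (prod_encode (n, i)) (Suc k)
    \<Longrightarrow> evals (Mu f) n m"

primrec recf_code :: "recf \<Rightarrow> nat" where
  "recf_code Zero = 0"
| "recf_code Succ = 1"
| "recf_code Proj1 = 2"
| "recf_code Proj2 = 3"
| "recf_code (PairF f g) = 4 + 4 * prod_encode (recf_code f, recf_code g)"
| "recf_code (Comp f g) = 5 + 4 * prod_encode (recf_code f, recf_code g)"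
| "recf_code (PrimRec f g) = 6 + 4 * prod_encode (recf_code f, recf_code g)"
| "recf_code (Mu f) = 7 + 4 * recf_code f"


section \<open>Algorithms on words and presentations\<close>

text \<open>Input and output of algorithms on words are words over generators named by natural
  numbers.\<close>

primrec letter_code :: "nat letter \<Rightarrow> nat" where
  "letter_code (Gen x) = 2 * x"
| "letter_code (Inv x) = 2 * x + 1"

definition word_code :: "nat word \<Rightarrow> nat" where
  "word_code w = list_encode (map letter_code w)"

definition solvable_word_problem :: "nat presentation \<Rightarrow> bool" where
  "solvable_word_problem P \<longleftrightarrow>
     (\<exists>D. \<forall>w \<in> words (gens P).
        evals D (word_code w)
          (if word_class P w = \<one>\<^bsub>presented_group P\<^esub> then 1 else 0))"

text \<open>A recursive presentation is given by a finite set \<open>Y\<close> together with a machine \<open>e\<close>; the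
  relators are the words that \<open>e\<close> outputs on those inputs on which it halts, so that finite
  sets of relators, including the empty one, can be enumerated.\<close>

definition is_recursive_presentation :: "nat set \<Rightarrow> recf \<Rightarrow> bool" where
  "is_recursive_presentation Y e \<longleftrightarrow>
     finite Y \<and> (\<forall>i k. evals e i k \<longrightarrow> k \<in> word_code ` words Y)"

definition recursive_presentation :: "nat set \<Rightarrow> recf \<Rightarrow> nat presentation" where
  "recursive_presentation Y e = Presentation Y {w. \<exists>i. evals e i (word_code w)}"

definition recursive_presentation_code :: "nat set \<Rightarrow> recf \<Rightarrow> nat" where
  "recursive_presentation_code Y e = prod_encode (set_encode Y, recf_code e)"

text \<open>A map from a finite set \<open>X\<close> to words is output as the list of its values, in increasing
  order of the generators.\<close>

definition gen_map_code :: "nat set \<Rightarrow> (nat \<Rightarrow> nat word) \<Rightarrow> nat" where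
  "gen_map_code X \<phi> = list_encode (map (\<lambda>x. word_code (\<phi> x)) (sorted_list_of_set X))"

end

theory Submission
  imports Defs
begin

text \<open>Let \<open>G = BS 2 3\<close>, with word problem solved by Britton normal forms, and let \<open>k\<close> be the
  commutator of \<open>s\<^sup>-\<^sup>1 t s\<close> and \<open>t\<close>, a nontrivial element generating, as a normal subgroup, the
  kernel of the surjective endomorphism \<open>s \<mapsto> s\<close>, \<open>t \<mapsto> t\<^sup>2\<close>; so \<open>G\<close> is isomorphic to
  \<open>G / \<langle>\<langle>k\<rangle>\<rangle>\<close>.  Given an algorithm as in the theorem, the recursion theorem provides a machine that
  enumerates the relator of \<open>G\<close>, runs the algorithm on the presentation which it enumerates itself,
  and, if the resulting \<open>\<phi>\<close> sends some nontrivial word \<open>w\<close> to \<open>k\<close> in \<open>G\<close>, also enumerates \<open>k\<close>.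
  If such a \<open>w\<close> exists, \<open>\<phi>\<close> does not induce an injection into \<open>G / \<langle>\<langle>k\<rangle>\<rangle>\<close>; if none exists, \<open>\<phi>\<close>
  does not induce a surjection onto \<open>G\<close>.\<close>

section \<open>Presented groups\<close>

lemma Nil_in_words [simp]: "[] \<in> words X"
  and Cons_in_words [simp]: "l # w \<in> words X \<longleftrightarrow> letter_gen l \<in> X \<and> w \<in> words X"
  and append_in_words [simp]: "u @ v \<in> words X \<longleftrightarrow> u \<in> words X \<and> v \<in> words X"
  by (auto simp: words_def)

lemma letter_gen_letter_inv [simp]: "letter_gen (letter_inv l) = letter_gen l"
  by (cases l) auto

lemma letter_inv_letter_inv [simp]: "letter_inv (letter_inv l) = l"
  by (cases l) auto

lemma word_inv_simps [simp]:
  "word_inv [] = []" "word_inv (l # w) = word_inv w @ [letter_inv l]"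
  "word_inv (u @ v) = word_inv v @ word_inv u"
  by (auto simp: word_inv_def)

lemma word_inv_word_inv [simp]: "word_inv (word_inv w) = w"
  by (induction w) auto

lemma word_inv_in_words [simp]: "word_inv w \<in> words X \<longleftrightarrow> w \<in> words X"
  by (induction w) auto

lemma word_eq_in_words:
  assumes "wf_presentation P" "word_eq P u v"
  shows "u \<in> words (gens P)" "v \<in> words (gens P)"
proof -
  have "u \<in> words (gens P) \<and> v \<in> words (gens P)"
    using assms(2) by induction (use assms(1) in \<open>auto simp: wf_presentation_def\<close>)
  then show "u \<in> words (gens P)" "v \<in> words (gens P)" by auto
qed

lemma word_eq_context:
  assumes "word_eq P u v" "a \<in> words (gens P)" "b \<in> words (gens P)"
  shows "word_eq P (a @ u @ b) (a @ v @ b)"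
  using assms
proof (induction)
  case (cancel u v l)
  then show ?case using word_eq.cancel[of "a @ u" P "v @ b" l] by simp
next
  case (relator u v r)
  then show ?case using word_eq.relator[of "a @ u" P "v @ b" r] by simp
next
  case (trans u v w)
  then show ?case by (blast intro: word_eq.trans)
qed (auto intro: word_eq.refl word_eq.sym)

lemma word_eq_append:
  assumes "wf_presentation P" "word_eq P u u'" "word_eq P v v'"
  shows "word_eq P (u @ v) (u' @ v')"
  using word_eq_context[OF assms(2), of "[]" v] word_eq_context[OF assms(3), of u' "[]"]
    word_eq_in_words[OF assms(1,2)] word_eq_in_words[OF assms(1,3)]
  by (auto intro: word_eq.trans)

lemma word_eq_right_inv: "w \<in> words (gens P) \<Longrightarrow> word_eq P (w @ word_inv w) []"
proof (induction w)
  case (Cons l w)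
  then have "word_eq P ([l] @ (w @ word_inv w) @ [letter_inv l]) ([l] @ [] @ [letter_inv l])"
    by (intro word_eq_context) auto
  moreover have "word_eq P [l, letter_inv l] []"
    using word_eq.cancel[of "[]" P "[]" l] Cons.prems by simp
  ultimately show ?case by (auto intro: word_eq.trans)
qed (auto intro: word_eq.refl)

lemma word_eq_left_inv: "w \<in> words (gens P) \<Longrightarrow> word_eq P (word_inv w @ w) []"
  using word_eq_right_inv[of "word_inv w" P] by simp

lemma word_eq_inv:
  assumes "wf_presentation P" "word_eq P u v"
  shows "word_eq P (word_inv u) (word_inv v)"
proof -
  note W = word_eq_in_words[OF assms]
  have "word_eq P (word_inv u @ v @ word_inv v) (word_inv u @ u @ word_inv v)"
    using assms(2) W by (intro word_eq_context) (auto intro: word_eq.sym)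
  moreover have "word_eq P (word_inv u @ u @ word_inv v) (word_inv v)"
    using word_eq_context[OF word_eq_left_inv[OF W(1)], of "[]" "word_inv v"] W by simp
  moreover have "word_eq P (word_inv u) (word_inv u @ v @ word_inv v)"
    using word_eq_context[OF word_eq_right_inv[OF W(2)], of "word_inv u" "[]"] W
    by (auto intro: word_eq.sym)
  ultimately show ?thesis by (blast intro: word_eq.trans)
qed

text \<open>For the projection of \<open>BS 2 3\<close> onto its quotient by the commutator: every
  derivation over \<open>P\<close> is also one over \<open>Q\<close>.\<close>

lemma word_eq_mono:
  assumes "gens P = gens Q" "rels P \<subseteq> rels Q" "word_eq P u v"
  shows "word_eq Q u v"
  using assms(3)
proof induction
  case (cancel u v l)
  then show ?case using word_eq.cancel[of u Q v l] assms(1) by simp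
next
  case (trans u v w)
  then show ?case by (blast intro: word_eq.trans)
qed (use assms(1,2) in \<open>auto intro: word_eq.refl word_eq.sym word_eq.relator\<close>)

lemma word_class_eq_iff:
  "u \<in> words (gens P) \<Longrightarrow> word_class P u = word_class P v \<longleftrightarrow> word_eq P u v"
proof
  assume "word_class P u = word_class P v" and "u \<in> words (gens P)"
  then have "u \<in> word_class P v"
    using word_eq.refl by (auto simp: word_class_def)
  then show "word_eq P u v" by (simp add: word_class_def word_eq.sym)
next
  assume uv: "word_eq P u v"
  have "word_eq P u z \<longleftrightarrow> word_eq P v z" for z
    using word_eq.trans[OF uv, of z] word_eq.trans[OF word_eq.sym[OF uv], of z] by (rule iffI[rotated])
  then show "word_class P u = word_class P v" by (simp add: word_class_def)
qed

section \<open>The group structure on congruence classes\<close>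

lemma in_word_class_iff [simp]: "v \<in> word_class P u \<longleftrightarrow> word_eq P u v"
  by (simp add: word_class_def)

lemma one_presented_group: "\<one>\<^bsub>presented_group P\<^esub> = word_class P []"
  by (simp add: presented_group_def)

lemma carrier_presented_group: "carrier (presented_group P) = word_class P ` words (gens P)"
  by (simp add: presented_group_def)

lemma word_class_eq_one_iff:
  "w \<in> words (gens P) \<Longrightarrow> word_class P w = \<one>\<^bsub>presented_group P\<^esub> \<longleftrightarrow> word_eq P w []"
  by (simp add: one_presented_group word_class_eq_iff)

lemma word_class_in_carrier [simp]:
  "w \<in> words (gens P) \<Longrightarrow> word_class P w \<in> carrier (presented_group P)"
  by (simp add: carrier_presented_group)

lemma mult_word_class:
  assumes "wf_presentation P" "u \<in> words (gens P)" "v \<in> words (gens P)"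
  shows "word_class P u \<otimes>\<^bsub>presented_group P\<^esub> word_class P v = word_class P (u @ v)"
proof -
  \<comment> \<open>The union defining the product runs over a nonempty family of representatives,
    all of which give one and the same class.\<close>
  have const: "word_class P (u' @ v') = word_class P (u @ v)"
    if "word_eq P u u'" "word_eq P v v'" for u' v'
    using word_eq_append[OF assms(1) that] assms(2,3) word_class_eq_iff[of "u @ v" P "u' @ v'"] by simp
  have "u \<in> word_class P u" "v \<in> word_class P v" using assms by (auto intro: word_eq.refl)
  then have "word_class P u \<noteq> {}" "word_class P v \<noteq> {}" by blast+
  moreover have "(\<Union>u'\<in>word_class P u. \<Union>v'\<in>word_class P v. word_class P (u' @ v')) =
      (\<Union>u'\<in>word_class P u. \<Union>v'\<in>word_class P v. word_class P (u @ v))"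
    by (intro SUP_cong HOL.refl const) simp_all
  ultimately show ?thesis by (simp add: presented_group_def)
qed

lemma group_presented_group:
  assumes "wf_presentation P" shows "group (presented_group P)"
proof (rule groupI)
  fix x assume "x \<in> carrier (presented_group P)"
  then obtain w where w: "w \<in> words (gens P)" "x = word_class P w"
    by (auto simp: carrier_presented_group)
  have "word_class P (word_inv w) \<otimes>\<^bsub>presented_group P\<^esub> x = \<one>\<^bsub>presented_group P\<^esub>"
    using w assms word_eq_left_inv[OF w(1)]
    by (simp add: mult_word_class word_class_eq_one_iff)
  then show "\<exists>y\<in>carrier (presented_group P). y \<otimes>\<^bsub>presented_group P\<^esub> x = \<one>\<^bsub>presented_group P\<^esub>"
    using w by (metis word_class_in_carrier word_inv_in_words)
qed (use assms in \<open>auto simp: carrier_presented_group one_presented_group mult_word_class\<close>)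

lemma inv_word_class:
  assumes "wf_presentation P" "w \<in> words (gens P)"
  shows "inv\<^bsub>presented_group P\<^esub> word_class P w = word_class P (word_inv w)"
  by (rule group.inv_equality[OF group_presented_group])
    (use assms word_eq_left_inv[of w P] in
      \<open>auto simp: mult_word_class word_class_eq_one_iff\<close>)

section \<open>Substitutions and the homomorphisms they induce\<close>

primrec letter_subst :: "('a \<Rightarrow> 'b word) \<Rightarrow> 'a letter \<Rightarrow> 'b word" where
  "letter_subst \<phi> (Gen x) = \<phi> x"
| "letter_subst \<phi> (Inv x) = word_inv (\<phi> x)"

definition word_subst :: "('a \<Rightarrow> 'b word) \<Rightarrow> 'a word \<Rightarrow> 'b word" where
  "word_subst \<phi> w = concat (map (letter_subst \<phi>) w)"

lemma word_subst_simps [simp]: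
  "word_subst \<phi> [] = []" "word_subst \<phi> (l # w) = letter_subst \<phi> l @ word_subst \<phi> w"
  "word_subst \<phi> (u @ v) = word_subst \<phi> u @ word_subst \<phi> v"
  by (auto simp: word_subst_def)

lemma letter_subst_letter_inv [simp]: "letter_subst \<phi> (letter_inv l) = word_inv (letter_subst \<phi> l)"
  by (cases l) auto

lemma word_subst_word_inv [simp]: "word_subst \<phi> (word_inv w) = word_inv (word_subst \<phi> w)"
  by (induction w) auto

lemma letter_subst_in_words: "\<phi> \<in> X \<rightarrow> words Y \<Longrightarrow> letter_gen l \<in> X \<Longrightarrow> letter_subst \<phi> l \<in> words Y"
  by (cases l) auto

lemma word_subst_in_words: "\<phi> \<in> X \<rightarrow> words Y \<Longrightarrow> w \<in> words X \<Longrightarrow> word_subst \<phi> w \<in> words Y"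
  by (induction w) (auto simp: letter_subst_in_words)

text \<open>Von Dyck's theorem on the level of words: each generating step of the congruence is
  carried to a congruence valid in \<open>Q\<close>.\<close>

lemma word_eq_subst:
  assumes Q: "wf_presentation Q" and \<phi>: "\<phi> \<in> gens P \<rightarrow> words (gens Q)"
    and rels: "\<And>r. r \<in> rels P \<Longrightarrow> word_eq Q (word_subst \<phi> r) []"
    and "word_eq P u v"
  shows "word_eq Q (word_subst \<phi> u) (word_subst \<phi> v)"
  using assms(4)
proof (induction)
  case (cancel u v l)
  then show ?case
    using word_eq_context[OF word_eq_right_inv, of "letter_subst \<phi> l" Q "word_subst \<phi> u" "word_subst \<phi> v"]
    by (auto simp: word_subst_in_words[OF \<phi>] letter_subst_in_words[OF \<phi>])
next
  case (relator u v r)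
  then show ?case
    using word_eq_context[OF rels, of r "word_subst \<phi> u" "word_subst \<phi> v"]
    by (auto simp: word_subst_in_words[OF \<phi>])
next
  case (trans u v w)
  then show ?case by (blast intro: word_eq.trans)
qed (auto intro: word_eq.refl word_eq.sym simp: word_subst_in_words[OF \<phi>])

lemma word_subst_id_on_gens:
  assumes P: "wf_presentation P" and \<xi>: "\<And>x. x \<in> gens P \<Longrightarrow> word_eq P (\<xi> x) [Gen x]"
    and "w \<in> words (gens P)"
  shows "word_eq P (word_subst \<xi> w) w"
  using assms(3)
proof (induction w)
  case (Cons l w)
  have "word_eq P (letter_subst \<xi> l) [l]"
    using \<xi>[of "letter_gen l"] word_eq_inv[OF P \<xi>[of "letter_gen l"]] Cons.prems by (cases l) auto
  from word_eq_append[OF P this Cons.IH] Cons.prems show ?case by simp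
qed (auto intro: word_eq.refl)

lemma word_subst_word_subst:
  "word_subst \<chi> (word_subst \<phi> w) = word_subst (\<lambda>x. word_subst \<chi> (\<phi> x)) w"
proof (induction w)
  case (Cons l w)
  then show ?case by (cases l) auto
qed auto

text \<open>By von Dyck both substitutions descend to the presented groups, and their composites are
  the identity because they fix the generators.\<close>

lemma presented_group_isoI:
  assumes P: "wf_presentation P" and Q: "wf_presentation Q"
    and \<phi>: "\<phi> \<in> gens P \<rightarrow> words (gens Q)" and \<chi>: "\<chi> \<in> gens Q \<rightarrow> words (gens P)"
    and rels_P: "\<And>r. r \<in> rels P \<Longrightarrow> word_eq Q (word_subst \<phi> r) []"
    and rels_Q: "\<And>r. r \<in> rels Q \<Longrightarrow> word_eq P (word_subst \<chi> r) []"
    and \<chi>\<phi>: "\<And>x. x \<in> gens P \<Longrightarrow> word_eq P (word_subst \<chi> (\<phi> x)) [Gen x]"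
    and \<phi>\<chi>: "\<And>y. y \<in> gens Q \<Longrightarrow> word_eq Q (word_subst \<phi> (\<chi> y)) [Gen y]"
  shows "presented_group P \<cong> presented_group Q"
proof -
  \<comment> \<open>\<open>SOME\<close> picks a representative of the class; the image class does
    not depend on the choice.\<close>
  define h where "h A = word_class Q (word_subst \<phi> (SOME w. w \<in> A))" for A
  have h: "h (word_class P w) = word_class Q (word_subst \<phi> w)" if "w \<in> words (gens P)" for w
  proof -
    have "word_eq P w (SOME v. v \<in> word_class P w)"
      using someI[of "\<lambda>v. v \<in> word_class P w" w] word_eq.refl[OF that] by simp
    from word_eq_subst[OF Q \<phi> rels_P this] show ?thesis
      by (simp add: h_def word_class_eq_iff[symmetric] word_subst_in_words[OF \<phi> that])
  qed
  have sub: "word_subst \<phi> w \<in> words (gens Q)" if "w \<in> words (gens P)" for w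
    using that by (rule word_subst_in_words[OF \<phi>])
  have "h \<in> hom (presented_group P) (presented_group Q)"
    by (rule homI) (auto simp: carrier_presented_group h sub mult_word_class P Q)
  moreover have "bij_betw h (carrier (presented_group P)) (carrier (presented_group Q))"
  proof (rule bij_betw_imageI)
    show "inj_on h (carrier (presented_group P))"
    proof (rule inj_onI)
      fix x y assume "x \<in> carrier (presented_group P)" "y \<in> carrier (presented_group P)"
        and eq: "h x = h y"
      then obtain u v where uv: "u \<in> words (gens P)" "v \<in> words (gens P)"
        "x = word_class P u" "y = word_class P v" by (auto simp: carrier_presented_group)
      with eq have "word_eq Q (word_subst \<phi> u) (word_subst \<phi> v)"
        by (simp add: h word_class_eq_iff sub)
      from word_eq_subst[OF P \<chi> rels_Q this]
      have "word_eq P (word_subst \<chi> (word_subst \<phi> u)) (word_subst \<chi> (word_subst \<phi> v))" .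
      moreover have "word_eq P (word_subst \<chi> (word_subst \<phi> w)) w" if "w \<in> words (gens P)" for w
        unfolding word_subst_word_subst using word_subst_id_on_gens[OF P \<chi>\<phi> that] .
      ultimately have "word_eq P u v"
        using uv(1,2) word_eq.trans[OF word_eq.sym word_eq.trans] by blast
      then show "x = y" using uv by (simp add: word_class_eq_iff)
    qed
    have "word_class Q w \<in> h ` carrier (presented_group P)" if w: "w \<in> words (gens Q)" for w
    proof -
      have "word_eq Q (word_subst \<phi> (word_subst \<chi> w)) w"
        unfolding word_subst_word_subst using word_subst_id_on_gens[OF Q \<phi>\<chi> w] .
      moreover have "word_subst \<chi> w \<in> words (gens P)" by (rule word_subst_in_words[OF \<chi> w])
      ultimately show ?thesis
        by (metis carrier_presented_group h imageI sub word_class_eq_iff)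
    qed
    then show "h ` carrier (presented_group P) = carrier (presented_group Q)"
      by (auto simp: carrier_presented_group h sub)
  qed
  ultimately show ?thesis by (auto simp: is_iso_def iso_def)
qed

text \<open>Induction on the word. It lets the isomorphism in \<open>extends_to_iso\<close> be
  replaced by substitution along \<phi>, which a program can carry out.\<close>

lemma hom_word_class:
  assumes P: "wf_presentation P" and Q: "wf_presentation Q"
    and \<phi>: "\<phi> \<in> gens P \<rightarrow> words (gens Q)"
    and h: "h \<in> hom (presented_group P) (presented_group Q)"
    and gens: "\<And>x. x \<in> gens P \<Longrightarrow> h (word_class P [Gen x]) = word_class Q (\<phi> x)"
    and "w \<in> words (gens P)"
  shows "h (word_class P w) = word_class Q (word_subst \<phi> w)"
proof -
  interpret group_hom "presented_group P" "presented_group Q" h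
    using h group_presented_group[OF P] group_presented_group[OF Q]
    by (simp add: group_hom_def group_hom_axioms_def)
  show ?thesis
    using assms(6)
  proof (induction w)
    case Nil
    show ?case using hom_one by (simp add: one_presented_group)
  next
    case (Cons l w)
    define x where "x = letter_gen l"
    have x: "x \<in> gens P" "\<phi> x \<in> words (gens Q)" using Cons.prems \<phi> by (auto simp: x_def)
    have "h (word_class P [Inv x]) = word_class Q (word_inv (\<phi> x))"
      using hom_inv[of "word_class P [Gen x]"] x
      by (simp add: inv_word_class[OF P] inv_word_class[OF Q] gens)
    then have l: "h (word_class P [l]) = word_class Q (letter_subst \<phi> l)"
      using gens[OF x(1)] by (cases l) (auto simp: x_def)
    have lw: "[l] \<in> words (gens P)" "w \<in> words (gens P)" using Cons.prems by auto
    have "word_class P (l # w) = word_class P [l] \<otimes>\<^bsub>presented_group P\<^esub> word_class P w"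
      by (simp only: mult_word_class[OF P lw] append_Cons append_Nil)
    also have "h \<dots> = word_class Q (letter_subst \<phi> l) \<otimes>\<^bsub>presented_group Q\<^esub> word_class Q (word_subst \<phi> w)"
      using lw by (simp add: l Cons.IH del: Cons_in_words)
    finally show ?case
      using Cons.prems
      by (simp add: mult_word_class[OF Q] letter_subst_in_words[OF \<phi>] word_subst_in_words[OF \<phi>])
  qed
qed

section \<open>Computable functions\<close>

text \<open>In the case of \<open>Mu\<close>, the body would return both 0 and a successor at the
  smaller of two different outputs.\<close>

lemma evals_functional: "evals f n k \<Longrightarrow> evals f n k' \<Longrightarrow> k = k'"
proof (induction arbitrary: k' rule: evals.induct)
  case (Mu f n m)
  from Mu.prems obtain "evals f (prod_encode (n, k')) 0"
    and "\<forall>i<k'. \<exists>k. evals f (prod_encode (n, i)) (Suc k)"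
    by cases auto
  with Mu.IH show ?case
    by (metis Zero_not_Suc linorder_neqE_nat)
next
  case (PrimRec_0 f a k g)
  from PrimRec_0.prems show ?case
    by cases (use PrimRec_0.IH in auto)
next
  case (PrimRec_Suc f g a n m k)
  from PrimRec_Suc.prems obtain m' where "evals (PrimRec f g) (prod_encode (a, n)) m'"
    and "evals g (prod_encode (a, prod_encode (n, m'))) k'"
    by cases auto
  with PrimRec_Suc.IH show ?case by blast
next
  case (Comp g n m f k)
  from Comp.prems show ?case by cases (use Comp.IH in blast)
next
  case (PairF f n a g b)
  from PairF.prems show ?case by cases (use PairF.IH in blast)
qed (auto elim: evals.cases)

lemma evals_Comp_iff: "evals (Comp f g) n k \<longleftrightarrow> (\<exists>m. evals g n m \<and> evals f m k)"
  by (auto intro: evals.Comp elim: evals.cases)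

lemma evals_PrimRec_0_iff: "evals (PrimRec f g) (prod_encode (a, 0)) k \<longleftrightarrow> evals f a k"
  by (auto intro: evals.PrimRec_0 elim: evals.cases)

lemma evals_PrimRec_Suc_iff: "evals (PrimRec f g) (prod_encode (a, Suc n)) k \<longleftrightarrow>
    (\<exists>m. evals (PrimRec f g) (prod_encode (a, n)) m \<and>
      evals g (prod_encode (a, prod_encode (n, m))) k)"
proof
  assume "evals (PrimRec f g) (prod_encode (a, Suc n)) k"
  then show "\<exists>m. evals (PrimRec f g) (prod_encode (a, n)) m \<and>
      evals g (prod_encode (a, prod_encode (n, m))) k" by cases auto
qed (auto intro: evals.PrimRec_Suc)

section \<open>Total computable functions and their closure properties\<close>

abbreviation pfst :: "nat \<Rightarrow> nat" where "pfst n \<equiv> fst (prod_decode n)"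
abbreviation psnd :: "nat \<Rightarrow> nat" where "psnd n \<equiv> snd (prod_decode n)"

definition computes :: "recf \<Rightarrow> (nat \<Rightarrow> nat) \<Rightarrow> bool" where
  "computes f F \<longleftrightarrow> (\<forall>n. evals f n (F n))"

definition computable :: "(nat \<Rightarrow> nat) \<Rightarrow> bool" where
  "computable F \<longleftrightarrow> (\<exists>f. computes f F)"

abbreviation decidable :: "(nat \<Rightarrow> bool) \<Rightarrow> bool" where
  "decidable P \<equiv> computable (\<lambda>n. of_bool (P n))"

lemma computes_iff: "computes f F \<Longrightarrow> evals f n k \<longleftrightarrow> k = F n"
  using evals_functional by (auto simp: computes_def)

lemma computes_Comp: "computes f F \<Longrightarrow> computes g G \<Longrightarrow> computes (Comp f g) (\<lambda>n. F (G n))"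
  by (auto simp: computes_def intro: evals.Comp)

lemma computes_PairF:
  "computes f F \<Longrightarrow> computes g G \<Longrightarrow> computes (PairF f g) (\<lambda>n. prod_encode (F n, G n))"
  by (auto simp: computes_def intro: evals.PairF)

lemma computes_Proj1: "computes Proj1 pfst"
  unfolding computes_def by (metis evals.Proj1 prod_decode_inverse prod.collapse)

lemma computes_Proj2: "computes Proj2 psnd"
  unfolding computes_def by (metis evals.Proj2 prod_decode_inverse prod.collapse)

lemma computes_id: "computes (PairF Proj1 Proj2) (\<lambda>n. n)"
  using computes_PairF[OF computes_Proj1 computes_Proj2] by simp

primrec Const :: "nat \<Rightarrow> recf" where
  "Const 0 = Zero"
| "Const (Suc n) = Comp Succ (Const n)"

lemma computes_Const: "computes (Const c) (\<lambda>_. c)"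
  by (induction c) (auto simp: computes_def intro: evals.intros)

lemma computes_PrimRec:
  assumes "computes f F" "computes g G"
  shows "computes (PrimRec f g) (\<lambda>z. rec_nat (F (pfst z))
    (\<lambda>n m. G (prod_encode (pfst z, prod_encode (n, m)))) (psnd z))"
proof -
  have "evals (PrimRec f g) (prod_encode (a, k))
      (rec_nat (F a) (\<lambda>n m. G (prod_encode (a, prod_encode (n, m)))) k)" for a k
    using assms by (induction k) (auto simp: computes_def intro: evals.intros)
  from this[of "pfst z" "psnd z" for z] show ?thesis by (simp add: computes_def)
qed

text \<open>As the body is total, the search cannot get stuck before a zero and stops at the least
  one.\<close>

lemma evals_Mu_iff:
  assumes "computes f F"
  shows "(\<exists>m. evals (Mu f) n m) \<longleftrightarrow> (\<exists>m. F (prod_encode (n, m)) = 0)"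
proof
  assume "\<exists>m. evals (Mu f) n m"
  then obtain m where "evals (Mu f) n m" by blast
  then show "\<exists>m. F (prod_encode (n, m)) = 0"
    by cases (use computes_iff[OF assms] in metis)
next
  assume "\<exists>m. F (prod_encode (n, m)) = 0"
  then have "F (prod_encode (n, LEAST m. F (prod_encode (n, m)) = 0)) = 0" (is "F (prod_encode (n, ?m)) = 0")
    by (rule LeastI_ex)
  moreover have "\<exists>k. F (prod_encode (n, i)) = Suc k" if "i < ?m" for i
    using not_less_Least[OF that] by (metis not0_implies_Suc)
  ultimately have "evals (Mu f) n ?m"
    by (intro evals.Mu) (auto simp: computes_iff[OF assms] eq_commute[of "Suc _"])
  then show "\<exists>m. evals (Mu f) n m" by blast
qed

named_theorems computable_intros

lemma computable_comp: "computable F \<Longrightarrow> computable G \<Longrightarrow> computable (\<lambda>n. F (G n))"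
  unfolding computable_def using computes_Comp by blast

lemma computable_comp2:
  assumes "computable (\<lambda>z. H (pfst z) (psnd z))" "computable F" "computable G"
  shows "computable (\<lambda>n. H (F n) (G n))"
proof -
  have "computable (\<lambda>n. prod_encode (F n, G n))"
    using assms(2,3) computes_PairF unfolding computable_def by blast
  from computable_comp[OF assms(1) this] show ?thesis by simp
qed

lemma computable_id [computable_intros]: "computable (\<lambda>n. n)"
  using computes_id computable_def by blast

lemma computable_const [computable_intros]: "computable (\<lambda>_. c)"
  using computes_Const computable_def by blast

lemma computable_Suc [computable_intros]: "computable F \<Longrightarrow> computable (\<lambda>n. Suc (F n))"
  using computable_comp[of Suc F] evals.Succ by (auto simp: computable_def computes_def)

lemma computable_pfst [computable_intros]: "computable F \<Longrightarrow> computable (\<lambda>n. pfst (F n))"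
  using computable_comp[of pfst F] computes_Proj1 by (auto simp: computable_def)

lemma computable_psnd [computable_intros]: "computable F \<Longrightarrow> computable (\<lambda>n. psnd (F n))"
  using computable_comp[of psnd F] computes_Proj2 by (auto simp: computable_def)

lemma computable_pair [computable_intros]:
  "computable F \<Longrightarrow> computable G \<Longrightarrow> computable (\<lambda>n. prod_encode (F n, G n))"
  unfolding computable_def using computes_PairF by blast

text \<open>The parameter \<open>x\<close> travels as the first component of a pair, so base, step
  and number of iterations may all depend on it.\<close>

lemma computable_rec_nat:
  assumes "computable F" "computable (\<lambda>z. G (pfst z) (pfst (psnd z)) (psnd (psnd z)))" "computable N"
  shows "computable (\<lambda>x. rec_nat (F x) (G x) (N x))"
proof -
  from assms(1,2) obtain f g where
    "computes f F" "computes g (\<lambda>z. G (pfst z) (pfst (psnd z)) (psnd (psnd z)))"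
    unfolding computable_def by blast
  from computes_PrimRec[OF this] have "computable (\<lambda>z. rec_nat (F (pfst z)) (G (pfst z)) (psnd z))"
    unfolding computable_def by auto
  from computable_comp2[OF this computable_id assms(3)] show ?thesis .
qed

lemma computable_add [computable_intros]:
  assumes "computable F" "computable G" shows "computable (\<lambda>n. F n + G n)"
proof -
  have "computable (\<lambda>n. rec_nat (F n) (\<lambda>_ r. Suc r) (G n))"
    by (intro computable_rec_nat computable_intros assms)
  moreover have "rec_nat a (\<lambda>_ r. Suc r) b = a + b" for a b by (induction b) auto
  ultimately show ?thesis by simp
qed

lemma computable_mult [computable_intros]:
  assumes "computable F" "computable G" shows "computable (\<lambda>n. F n * G n)"
proof -
  have "computable (\<lambda>n. rec_nat 0 (\<lambda>_ r. r + F n) (G n))"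
    by (intro computable_rec_nat computable_intros computable_comp[OF assms(1)] assms)
  moreover have "rec_nat 0 (\<lambda>_ r. r + a) b = a * b" for a b :: nat by (induction b) auto
  ultimately show ?thesis by simp
qed

lemma computable_pred:
  assumes "computable F" shows "computable (\<lambda>n. F n - Suc 0)"
proof -
  have "computable (\<lambda>n. rec_nat 0 (\<lambda>k _. k) (F n))"
    by (intro computable_rec_nat computable_intros assms)
  moreover have "rec_nat 0 (\<lambda>k _. k) b = b - Suc 0" for b by (cases b) auto
  ultimately show ?thesis by simp
qed

lemma computable_diff [computable_intros]:
  assumes "computable F" "computable G" shows "computable (\<lambda>n. F n - G n)"
proof -
  have "computable (\<lambda>n. rec_nat (F n) (\<lambda>_ r. r - Suc 0) (G n))"
    by (intro computable_rec_nat computable_pred computable_intros assms)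
  moreover have "rec_nat a (\<lambda>_ r. r - Suc 0) b = a - b" for a b by (induction b) auto
  ultimately show ?thesis by simp
qed

lemma decidable_eq [computable_intros]:
  assumes "computable F" "computable G" shows "decidable (\<lambda>n. F n = G n)"
proof -
  have "computable (\<lambda>n. 1 - ((F n - G n) + (G n - F n)))"
    by (intro computable_intros assms)
  moreover have "1 - ((a - b) + (b - a)) = of_bool (a = b)" for a b :: nat by auto
  ultimately show ?thesis by simp
qed

lemma decidable_less [computable_intros]:
  assumes "computable F" "computable G" shows "decidable (\<lambda>n. F n < G n)"
proof -
  have "computable (\<lambda>n. 1 - (1 - (G n - F n)))"
    by (intro computable_intros assms)
  moreover have "1 - (1 - (b - a)) = of_bool (a < b)" for a b :: nat by auto
  ultimately show ?thesis by simp
qed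

lemma decidable_conj [computable_intros]:
  assumes "decidable P" "decidable Q" shows "decidable (\<lambda>n. P n \<and> Q n)"
  using computable_mult[OF assms] by (simp add: of_bool_conj)

lemma decidable_not [computable_intros]:
  assumes "decidable P" shows "decidable (\<lambda>n. \<not> P n)"
proof -
  have "computable (\<lambda>n. (1::nat) - of_bool (P n))" by (intro computable_intros assms)
  moreover have "(1::nat) - of_bool (P n) = of_bool (\<not> P n)" for n by simp
  ultimately show ?thesis by (simp only:)
qed

lemma computable_if [computable_intros]:
  assumes "decidable P" "computable F" "computable G"
  shows "computable (\<lambda>n. if P n then F n else G n)"
proof -
  have "computable (\<lambda>n. of_bool (P n) * F n + of_bool (\<not> P n) * G n)"
    by (intro computable_intros assms)
  moreover have "of_bool (P n) * F n + of_bool (\<not> P n) * G n = (if P n then F n else G n)" for n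
    by simp
  ultimately show ?thesis by simp
qed

lemma computable_mod [computable_intros]:
  assumes "computable F" shows "computable (\<lambda>n. F n mod c)"
proof -
  \<comment> \<open>A counter that returns to 0 on reaching \<open>c\<close>; for
    \<open>c = 0\<close> it never does, in agreement with \<open>a mod 0 = a\<close>.\<close>
  have "computable (\<lambda>n. rec_nat 0 (\<lambda>_ r. if Suc r = c then 0 else Suc r) (F n))"
    by (intro computable_rec_nat computable_intros assms)
  moreover have "rec_nat 0 (\<lambda>_ r. if Suc r = c then 0 else Suc r) a = a mod c" for a
    by (induction a) (auto simp: mod_Suc)
  ultimately show ?thesis by simp
qed

lemma computable_div [computable_intros]:
  assumes "computable F" shows "computable (\<lambda>n. F n div c)"
proof -
  have "computable (\<lambda>n. rec_nat 0 (\<lambda>k q. if Suc k mod c = 0 then Suc q else q) (F n))"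
    by (intro computable_rec_nat computable_intros assms)
  moreover have "rec_nat 0 (\<lambda>k q. if Suc k mod c = 0 then Suc q else q) a = a div c" for a
    by (induction a) (auto simp: div_Suc)
  ultimately show ?thesis by simp
qed

section \<open>Folds over coded lists\<close>

lemma length_le_list_encode: "length xs \<le> list_encode xs"
  by (induction xs) (auto intro: order_trans[OF _ le_prod_encode_2])

text \<open>Primitive recursion on pairs of a coded remaining list and an accumulator. The empty
  list has code 0 and a nonempty one is the successor of the pair of head and tail, so
  \<open>step\<close> takes off one element and leaves a finished pair fixed.\<close>

lemma computable_fold:
  assumes g: "computable (\<lambda>z. g (pfst z) (pfst (psnd z)) (psnd (psnd z)))"
    and L: "computable L" and F: "computable F"
  shows "computable (\<lambda>x. fold (g x) (list_decode (L x)) (F x))"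
proof -
  define step where "step x p = (if pfst p = 0 then p
    else prod_encode (psnd (pfst p - 1), g x (pfst (pfst p - 1)) (psnd p)))" for x p
  have iter: "rec_nat (prod_encode (list_encode xs, a)) (\<lambda>_. step x) n =
      prod_encode (list_encode (drop n xs), fold (g x) (take n xs) a)" for x xs a n
  proof (induction n)
    case (Suc n)
    show ?case
    proof (cases "n < length xs")
      case True
      then have "step x (prod_encode (list_encode (drop n xs), fold (g x) (take n xs) a)) =
          prod_encode (list_encode (drop (Suc n) xs), fold (g x) (take (Suc n) xs) a)"
        by (simp add: step_def Cons_nth_drop_Suc[symmetric] take_Suc_conv_app_nth)
      then show ?thesis by (simp only: Suc.IH old.nat.simps(7))
    next
      case False
      then have "step x (prod_encode (list_encode (drop n xs), fold (g x) (take n xs) a)) =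
          prod_encode (list_encode (drop (Suc n) xs), fold (g x) (take (Suc n) xs) a)"
        by (simp add: step_def)
      then show ?thesis by (simp only: Suc.IH old.nat.simps(7))
    qed
  qed simp
  have step: "computable (\<lambda>z. step (pfst z) (psnd (psnd z)))"
  proof -
    have "computable (\<lambda>z. (\<lambda>z. g (pfst z) (pfst (psnd z)) (psnd (psnd z)))
        (prod_encode (pfst z, prod_encode (pfst (pfst (psnd (psnd z)) - 1), psnd (psnd (psnd z))))))"
      by (rule computable_comp[OF g]) (intro computable_intros)
    then show ?thesis unfolding step_def by (intro computable_intros) simp
  qed
  \<comment> \<open>The code bounds the length of the list, and surplus iterations change
    nothing.\<close>
  have "computable (\<lambda>x. psnd (rec_nat (prod_encode (L x, F x)) (\<lambda>_. step x) (L x)))"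
    by (intro computable_psnd computable_rec_nat computable_intros L F step)
  moreover have "psnd (rec_nat (prod_encode (L x, F x)) (\<lambda>_. step x) (L x)) =
      fold (g x) (list_decode (L x)) (F x)" for x
    using iter[of "list_decode (L x)" "F x" x "L x"]
      length_le_list_encode[of "list_decode (L x)"] by simp
  ultimately show ?thesis by simp
qed

text \<open>The fixed point is obtained by hard-wiring the code of
  \<open>p\<close> into \<open>p\<close> itself, so that no universal program is needed.\<close>

lemma recursion_theorem:
  "\<exists>e. \<forall>i k. evals e i k \<longleftrightarrow> evals f (prod_encode (recf_code e, i)) k"
proof -
  define hardwire where "hardwire p x = Comp p (PairF (Const x) (PairF Proj1 Proj2))" for p x
  \<comment> \<open>If \<open>x\<close> is the code of \<open>p\<close>, then \<open>diag x\<close>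
    is the code of \<open>hardwire p x\<close>, that is, of \<open>p\<close> supplied with its own
    code; 5 and 4 are the offsets of \<open>Comp\<close> and \<open>PairF\<close> in
    \<open>recf_code\<close>.\<close>
  define diag where "diag x = 5 + 4 * prod_encode (x, 4 + 4 * prod_encode
    (recf_code (Const x), recf_code (PairF Proj1 Proj2)))" for x
  have "recf_code (Const x) = rec_nat 0 (\<lambda>_ r. 5 + 4 * prod_encode (1, r)) x" for x
    by (induction x) auto
  then have "computable diag"
    unfolding diag_def by (simp only:) (intro computable_rec_nat computable_intros)
  then obtain d where d: "computes d diag" unfolding computable_def by blast
  \<comment> \<open>\<open>p\<close> applies \<open>diag\<close> to its hard-wired argument; when
    this is the code of \<open>p\<close>, the result is the code of \<open>e\<close>.\<close>
  define p where "p = Comp f (PairF (Comp d Proj1) Proj2)"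
  define e where "e = hardwire p (recf_code p)"
  have "recf_code e = diag (recf_code p)"
    by (simp add: e_def hardwire_def diag_def)
  moreover have "evals (PairF (Const x) (PairF Proj1 Proj2)) i k \<longleftrightarrow> k = prod_encode (x, i)" for x i k
    by (intro computes_iff computes_PairF computes_Const computes_id)
  moreover have "evals (PairF (Comp d Proj1) Proj2) z k \<longleftrightarrow> k = prod_encode (diag (pfst z), psnd z)" for z k
    by (intro computes_iff computes_PairF computes_Comp d computes_Proj1 computes_Proj2)
  ultimately have "evals e i k \<longleftrightarrow> evals f (prod_encode (recf_code e, i)) k" for i k
    by (simp add: e_def hardwire_def p_def evals_Comp_iff del: recf_code.simps)
  then show ?thesis by blast
qed

section \<open>The word problem of the Baumslag--Solitar groups\<close>

text \<open>A state \<open>([(a\<^sub>k, \<epsilon>\<^sub>k), \<dots>, (a\<^sub>1, \<epsilon>\<^sub>1)], N)\<close> stands for the group element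
  \<open>t\<^bsup>a\<^sub>1\<^esup> s\<^bsup>\<epsilon>\<^sub>1\<^esup> \<dots> t\<^bsup>a\<^sub>k\<^esup> s\<^bsup>\<epsilon>\<^sub>k\<^esup> t\<^bsup>N\<^esup>\<close>, where \<open>True\<close> and \<open>False\<close> are the
  exponents \<open>1\<close> and \<open>-1\<close>.  Letters act on Britton normal forms by right multiplication, which
  moves powers of \<open>t\<close> rightwards by \<open>t\<^sup>m s = s t\<^sup>n\<close> and \<open>t\<^sup>n s\<^sup>-\<^sup>1 = s\<^sup>-\<^sup>1 t\<^sup>m\<close>.\<close>

type_synonym bs_state = "(nat \<times> bool) list \<times> int"

text \<open>With \<open>p = bs_in m n \<epsilon>\<close> and
  \<open>q = bs_out m n \<epsilon>\<close>, both forms of the relation read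
  \<open>t^p s^\<epsilon> = s^\<epsilon> t^q\<close>.\<close>

definition bs_in :: "nat \<Rightarrow> nat \<Rightarrow> bool \<Rightarrow> nat" where
  "bs_in m n \<epsilon> = (if \<epsilon> then m else n)"

abbreviation bs_out :: "nat \<Rightarrow> nat \<Rightarrow> bool \<Rightarrow> nat" where
  "bs_out m n \<epsilon> \<equiv> bs_in m n (\<not> \<epsilon>)"

text \<open>For \<open>N = r + p k\<close>, the power \<open>t^(p k)\<close> passes
  \<open>s^\<epsilon>\<close> as \<open>t^(q k)\<close>. If \<open>r = 0\<close> and the last
  syllable ends in the inverse of \<open>s^\<epsilon>\<close>, the two cancel; otherwise
  \<open>t^r s^\<epsilon>\<close> is a new syllable.\<close>

definition bs_s :: "nat \<Rightarrow> nat \<Rightarrow> bool \<Rightarrow> bs_state \<Rightarrow> bs_state" where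
  "bs_s m n \<epsilon> = (\<lambda>(xs, N). let p = int (bs_in m n \<epsilon>); q = int (bs_out m n \<epsilon>) in
     if N mod p = 0 \<and> xs \<noteq> [] \<and> snd (hd xs) \<noteq> \<epsilon>
     then (tl xs, int (fst (hd xs)) + q * (N div p))
     else ((nat (N mod p), \<epsilon>) # xs, q * (N div p)))"

definition bs_t :: "bool \<Rightarrow> bs_state \<Rightarrow> bs_state" where
  "bs_t \<epsilon> = (\<lambda>(xs, N). (xs, if \<epsilon> then N + 1 else N - 1))"

definition bs_act :: "nat \<Rightarrow> nat \<Rightarrow> nat letter \<Rightarrow> bs_state \<Rightarrow> bs_state" where
  "bs_act m n l = (case l of
     Gen x \<Rightarrow> (if x = 0 then bs_s m n True else bs_t True)
   | Inv x \<Rightarrow> (if x = 0 then bs_s m n False else bs_t False))"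

text \<open>Britton normal forms: exponents are least residues modulo \<open>p\<close>, and
  neighbouring syllables do not cancel. The final power of \<open>t\<close> is unrestricted.\<close>

fun bs_reduced :: "nat \<Rightarrow> nat \<Rightarrow> (nat \<times> bool) list \<Rightarrow> bool" where
  "bs_reduced m n [] = True"
| "bs_reduced m n ((a, \<epsilon>) # xs) \<longleftrightarrow> a < bs_in m n \<epsilon> \<and> bs_reduced m n xs \<and>
     \<not> (a = 0 \<and> xs \<noteq> [] \<and> snd (hd xs) \<noteq> \<epsilon>)"

lemma rels_BS: "rels (BS m n) =
    {[Inv 0] @ replicate m (Gen 1) @ [Gen 0] @ replicate n (Inv 1)}"
  by (simp add: BS_def word_inv_def)

lemma gens_BS [simp]: "gens (BS m n) = {0, 1}"
  by (simp add: BS_def)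

lemma replicate_in_words [simp]: "replicate k l \<in> words X \<longleftrightarrow> k = 0 \<or> letter_gen l \<in> X"
  by (induction k) auto

lemma wf_BS: "wf_presentation (BS m n)"
  by (simp add: wf_presentation_def rels_BS)

lemma finite_presentation_BS: "finite_presentation (BS m n)"
  by (simp add: finite_presentation_def wf_BS rels_BS)

section \<open>The action on normal forms\<close>

context
  fixes m n :: nat
  assumes pos: "m > 0" "n > 0"
begin

lemma bs_in_pos: "bs_in m n \<epsilon> > 0"
  using pos by (simp add: bs_in_def)

lemma bs_s_reduced:
  assumes "bs_reduced m n (fst st)" shows "bs_reduced m n (fst (bs_s m n \<epsilon> st))"
proof -
  obtain xs N where st: "st = (xs, N)" by fastforce
  have "nat (N mod int (bs_in m n \<epsilon>)) < bs_in m n \<epsilon>"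
    using bs_in_pos[of \<epsilon>] by (simp add: nat_less_iff)
  moreover have "N mod int (bs_in m n \<epsilon>) \<le> 0 \<longleftrightarrow> N mod int (bs_in m n \<epsilon>) = 0"
    using bs_in_pos[of \<epsilon>] pos_mod_sign[of "int (bs_in m n \<epsilon>)" N] by linarith
  ultimately show ?thesis
    using assms by (cases xs) (auto simp: st bs_s_def Let_def)
qed

text \<open>A new syllable is taken off again at once. A removed one comes back, because its
  exponent \<open>a < q\<close> is recovered as a remainder and reducedness rules out a further
  cancellation.\<close>

lemma bs_s_inverse:
  assumes "bs_reduced m n (fst st)" shows "bs_s m n (\<not> \<epsilon>) (bs_s m n \<epsilon> st) = st"
proof -
  obtain xs N where st: "st = (xs, N)" by fastforce
  define p where "p = bs_in m n \<epsilon>"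
  define q where "q = bs_out m n \<epsilon>"
  have pq: "p > 0" "q > 0" using bs_in_pos by (auto simp: p_def q_def)
  have N: "int p * (N div int p) = N" if "N mod int p = 0" using that by auto
  show ?thesis
  proof (cases "N mod int p = 0 \<and> xs \<noteq> [] \<and> snd (hd xs) \<noteq> \<epsilon>")
    case True
    then obtain a ys where xs: "xs = (a, \<not> \<epsilon>) # ys" by (cases xs) auto
    with assms have "a < q" and "\<not> (a = 0 \<and> ys \<noteq> [] \<and> snd (hd ys) = \<epsilon>)"
      by (auto simp: st q_def)
    then show ?thesis
      using True pq N by (auto simp: st xs bs_s_def Let_def p_def[symmetric] q_def[symmetric])
  next
    case False
    then show ?thesis
      using pq by (auto simp: st bs_s_def Let_def p_def[symmetric] q_def[symmetric])
  qed
qed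

lemma bs_t_inverse: "bs_t (\<not> \<epsilon>) (bs_t \<epsilon> st) = st"
  by (simp add: bs_t_def split: prod.splits)

lemma bs_act_inverse:
  "bs_reduced m n (fst st) \<Longrightarrow> bs_act m n (letter_inv l) (bs_act m n l st) = st"
  using bs_s_inverse[of st True] bs_s_inverse[of st False] bs_t_inverse[of True st] bs_t_inverse[of False st]
  by (cases l) (auto simp: bs_act_def)

lemma bs_act_reduced:
  "bs_reduced m n (fst st) \<Longrightarrow> bs_reduced m n (fst (bs_act m n l st))"
  using bs_s_reduced by (cases l) (auto simp: bs_act_def bs_t_def split: prod.splits)

lemma fold_bs_act_reduced:
  "bs_reduced m n (fst st) \<Longrightarrow> bs_reduced m n (fst (fold (bs_act m n) w st))"
  by (induction w arbitrary: st) (auto simp: bs_act_reduced)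

lemma fold_bs_act_replicate:
  "fold (bs_act m n) (replicate k (Gen (Suc 0))) (xs, N) = (xs, N + int k)"
  "fold (bs_act m n) (replicate k (Inv (Suc 0))) (xs, N) = (xs, N - int k)"
  by (induction k arbitrary: N) (auto simp: bs_act_def bs_t_def)

lemma bs_s_shift:
  "bs_s m n False (xs, N + int n) = (fst (bs_s m n False (xs, N)), snd (bs_s m n False (xs, N)) + int m)"
proof -
  have "(N + int n) div int n = N div int n + 1"
    by (rule div_add_self2) (use pos in simp)
  then show ?thesis by (simp add: bs_s_def bs_in_def Let_def distrib_left)
qed

lemma fold_bs_act_relator:
  assumes "bs_reduced m n (fst st)" "r \<in> rels (BS m n)"
  shows "fold (bs_act m n) r st = st"
proof -
  obtain xs N where st: "st = (xs, N)" by fastforce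
  obtain ys M where 1: "bs_s m n False st = (ys, M)" by fastforce
  \<comment> \<open>By the shift, \<open>s^-1 t^m\<close> leads to the state that
    \<open>s^-1\<close> makes of \<open>(xs, N + int n)\<close>; then \<open>s\<close> returns to
    the latter, and the trailing \<open>t^-n\<close> of the relator restores
    \<open>N\<close>.\<close>
  have "bs_s m n True (ys, M + int m) = (xs, N + int n)"
    using bs_s_shift[of xs N] bs_s_inverse[of "(xs, N + int n)" False] assms(1) 1 by (simp add: st)
  then show ?thesis
    using assms(2) 1 by (simp add: rels_BS st fold_bs_act_replicate bs_act_def[of _ _ "_ 0"] del: fold_replicate)
qed

text \<open>Letters act invertibly on reduced states and the relator acts trivially, so the action
  factors through the group: different final states prove words different.\<close>

lemma fold_bs_act_word_eq:
  assumes "word_eq (BS m n) u v" "bs_reduced m n (fst st)"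
  shows "fold (bs_act m n) u st = fold (bs_act m n) v st"
  using assms
  by (induction arbitrary: st)
    (auto simp: bs_act_inverse fold_bs_act_reduced fold_bs_act_relator)

end

section \<open>Evaluating states in the group\<close>

lemma (in group) inv_mult_eq_mult_inv:
  assumes "a \<in> carrier G" "b \<in> carrier G" "c \<in> carrier G" "d \<in> carrier G"
    and eq: "a \<otimes> b = c \<otimes> d"
  shows "inv c \<otimes> a = d \<otimes> inv b"
proof -
  have "inv c \<otimes> a = inv c \<otimes> (a \<otimes> b) \<otimes> inv b"
    using assms(1-4) by (simp add: m_assoc)
  also have "\<dots> = d \<otimes> inv b"
    using assms(1-4) by (simp add: eq flip: m_assoc)
  finally show ?thesis .
qed

lemma (in group) int_pow_commute_past:
  assumes "x \<in> carrier G" "y \<in> carrier G" "s \<in> carrier G" and xs: "x \<otimes> s = s \<otimes> y"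
  shows "x [^] (k::int) \<otimes> s = s \<otimes> y [^] k"
proof -
  have nat: "x [^] (k::nat) \<otimes> s = s \<otimes> y [^] k" for k
  proof (induction k)
    case (Suc k)
    have "x [^] Suc k \<otimes> s = x [^] k \<otimes> (s \<otimes> y)"
      using assms by (simp add: m_assoc)
    also have "\<dots> = s \<otimes> y [^] Suc k"
      using assms Suc.IH by (simp flip: m_assoc)
    finally show ?case .
  qed (use assms in simp)
  have "inv (x [^] k) \<otimes> s = s \<otimes> inv (y [^] k)" for k :: nat
    by (rule inv_mult_eq_mult_inv[OF _ _ _ _ nat[symmetric]]) (use assms(1-3) in simp_all)
  with nat show ?thesis
    using assms(1,2) by (cases k rule: int_cases2) (simp_all only: int_pow_int int_pow_neg_int)
qed

text \<open>The head of the list is the rightmost syllable, so each step multiplies on the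
  right.\<close>

primrec bs_prefix :: "('g, 'b) monoid_scheme \<Rightarrow> 'g \<Rightarrow> 'g \<Rightarrow> (nat \<times> bool) list \<Rightarrow> 'g" where
  "bs_prefix G s t [] = \<one>\<^bsub>G\<^esub>"
| "bs_prefix G s t (x # xs) = bs_prefix G s t xs \<otimes>\<^bsub>G\<^esub>
     (t [^]\<^bsub>G\<^esub> int (fst x) \<otimes>\<^bsub>G\<^esub> (if snd x then s else inv\<^bsub>G\<^esub> s))"

definition bs_val :: "('g, 'b) monoid_scheme \<Rightarrow> 'g \<Rightarrow> 'g \<Rightarrow> bs_state \<Rightarrow> 'g" where
  "bs_val G s t st = bs_prefix G s t (fst st) \<otimes>\<^bsub>G\<^esub> t [^]\<^bsub>G\<^esub> snd st"

text \<open>Both branches of \<open>bs_s\<close> are identities in any group with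
  \<open>t^m s = s t^n\<close>: move \<open>t^(p k)\<close> past \<open>s^\<epsilon>\<close>, and in
  the first branch cancel.\<close>

lemma (in group) bs_val_bs_s:
  assumes pos: "m > 0" "n > 0" and st: "s \<in> carrier G" "t \<in> carrier G" and rel: "t [^] int m \<otimes> s = s \<otimes> t [^] int n"
  shows "bs_val G s t (bs_s m n \<epsilon> x) = bs_val G s t x \<otimes> (if \<epsilon> then s else inv s)"
proof -
  define u where "u \<epsilon> = (if \<epsilon> then s else inv s)" for \<epsilon>
  define p where "p = int (bs_in m n \<epsilon>)"
  define q where "q = int (bs_out m n \<epsilon>)"
  obtain xs N where x: "x = (xs, N)" by fastforce
  have u [simp]: "u \<epsilon> \<in> carrier G" for \<epsilon> using st by (simp add: u_def)
  have uu: "u (\<not> \<epsilon>) \<otimes> u \<epsilon> = \<one>" using st by (simp add: u_def)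
  have prefix [simp]: "bs_prefix G s t ys \<in> carrier G" for ys
    using st by (induction ys) auto
  have rel': "t [^] int n \<otimes> inv s = inv s \<otimes> t [^] int m"
    using st by (intro inv_mult_eq_mult_inv[symmetric] rel) auto
  have "t [^] p \<otimes> u \<epsilon> = u \<epsilon> \<otimes> t [^] q"
    using rel rel' by (simp add: p_def q_def u_def bs_in_def)
  from int_pow_commute_past[OF _ _ _ this]
  have move: "t [^] (p * k) \<otimes> u \<epsilon> = u \<epsilon> \<otimes> t [^] (q * k)" for k
    using st by (simp add: int_pow_pow)
  show ?thesis
  proof (cases "N mod p = 0 \<and> xs \<noteq> [] \<and> snd (hd xs) \<noteq> \<epsilon>")
    case True
    then obtain a ys where xs: "xs = (a, \<not> \<epsilon>) # ys" by (cases xs) auto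
    define k where "k = N div p"
    have N: "N = p * k" using True by (auto simp: k_def)
    have "bs_s m n \<epsilon> x = (ys, int a + q * k)"
      using True by (simp add: x xs bs_s_def Let_def p_def[symmetric] q_def[symmetric] k_def)
    moreover have "bs_val G s t x \<otimes> u \<epsilon> =
        bs_prefix G s t ys \<otimes> (t [^] int a \<otimes> (u (\<not> \<epsilon>) \<otimes> (t [^] (p * k) \<otimes> u \<epsilon>)))"
      using st by (simp add: bs_val_def x xs N m_assoc u_def)
    moreover have "u (\<not> \<epsilon>) \<otimes> (t [^] (p * k) \<otimes> u \<epsilon>) = t [^] (q * k)"
      using st uu by (simp add: move flip: m_assoc)
    ultimately show ?thesis
      using st by (simp add: bs_val_def int_pow_mult u_def)
  next
    case False
    define k where "k = N div p"
    define a where "a = N mod p"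
    have N: "N = a + p * k" by (simp add: k_def a_def)
    have "a \<ge> 0" using pos by (simp add: a_def p_def bs_in_def)
    have "bs_s m n \<epsilon> x = ((nat a, \<epsilon>) # xs, q * k)"
      using False by (auto simp add: x bs_s_def Let_def p_def[symmetric] q_def[symmetric] k_def a_def)
    moreover have "bs_val G s t x \<otimes> u \<epsilon> =
        bs_prefix G s t xs \<otimes> (t [^] a \<otimes> (t [^] (p * k) \<otimes> u \<epsilon>))"
      using st by (simp add: bs_val_def x N m_assoc int_pow_mult)
    ultimately show ?thesis
      using st \<open>a \<ge> 0\<close> by (simp add: bs_val_def move m_assoc flip: u_def)
  qed
qed

lemma word_class_replicate:
  assumes "wf_presentation P" "letter_gen l \<in> gens P"
  shows "word_class P (replicate k l) = word_class P [l] [^]\<^bsub>presented_group P\<^esub> int k"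
proof -
  have "word_class P (replicate k l) = word_class P [l] [^]\<^bsub>presented_group P\<^esub> k"
  proof (induction k)
    case (Suc k)
    then show ?case
      using assms mult_word_class[OF assms(1), of "replicate k l" "[l]"]
      by (simp add: replicate_append_same)
  qed (simp add: one_presented_group)
  then show ?thesis by (simp add: int_pow_int)
qed

lemma word_class_BS_relation:
  fixes m n and G (structure) defines "G \<equiv> presented_group (BS m n)"
    and "s \<equiv> word_class (BS m n) [Gen 0]" and "t \<equiv> word_class (BS m n) [Gen 1]"
  shows "t [^]\<^bsub>G\<^esub> int m \<otimes>\<^bsub>G\<^esub> s = s \<otimes>\<^bsub>G\<^esub> t [^]\<^bsub>G\<^esub> int n"
proof -
  interpret group G unfolding G_def by (rule group_presented_group[OF wf_BS])
  let ?c = "word_class (BS m n)"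
  have st: "s \<in> carrier G" "t \<in> carrier G" by (simp_all add: s_def t_def G_def)
  have mult: "?c (u @ v) = ?c u \<otimes> ?c v" if "u \<in> words {0, 1}" "v \<in> words {0, 1}" for u v
    using mult_word_class[OF wf_BS, of u m n v] that by (simp add: G_def)
  have inv: "?c (word_inv w) = inv ?c w" if "w \<in> words {0, 1}" for w
    using inv_word_class[OF wf_BS, of w m n] that by (simp add: G_def)
  have pow: "?c (replicate k (Gen 1)) = t [^] int k" for k
    using word_class_replicate[OF wf_BS, of "Gen 1" m n k] by (simp add: G_def t_def)
  have "?c (word_inv [Gen 0] @ replicate m (Gen 1) @ [Gen 0] @ word_inv (replicate n (Gen 1))) = \<one>"
    using word_eq.relator[of "[]" "BS m n" "[]"]
    by (subst G_def, subst word_class_eq_one_iff) (auto simp: rels_BS word_inv_def)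
  then have "inv s \<otimes> (t [^] int m \<otimes> (s \<otimes> inv (t [^] int n))) = \<one>"
    by (simp only: mult inv pow s_def[symmetric] append_in_words word_inv_in_words
        replicate_in_words Cons_in_words Nil_in_words letter_gen.simps insert_iff simp_thms)
  then have "t [^] int m \<otimes> (s \<otimes> inv (t [^] int n)) = s"
    using st by (metis int_pow_closed inv_closed inv_equality inv_inv m_closed inv_comm)
  then show ?thesis
    using st by (metis int_pow_closed inv_closed inv_solve_right' m_assoc m_closed)
qed

text \<open>Converse to \<open>fold_bs_act_word_eq\<close>: started at the trivial state, the final
  state determines the class of \<open>w\<close>.\<close>

lemma bs_val_fold_bs_act:
  fixes m n and G (structure) defines "G \<equiv> presented_group (BS m n)"
    and "s \<equiv> word_class (BS m n) [Gen 0]" and "t \<equiv> word_class (BS m n) [Gen 1]"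
  assumes pos: "m > 0" "n > 0" and "w \<in> words {0, 1}"
  shows "bs_val G s t (fold (bs_act m n) w x) = bs_val G s t x \<otimes>\<^bsub>G\<^esub> word_class (BS m n) w"
proof -
  interpret group G unfolding G_def by (rule group_presented_group[OF wf_BS])
  have st: "s \<in> carrier G" "t \<in> carrier G" by (simp_all add: s_def t_def G_def)
  have prefix: "bs_prefix G s t ys \<in> carrier G" for ys
    using st by (induction ys) auto
  then have val: "bs_val G s t x \<in> carrier G" for x
    using st by (simp add: bs_val_def)
  have rel: "t [^] int m \<otimes> s = s \<otimes> t [^] int n"
    unfolding G_def s_def t_def by (rule word_class_BS_relation)
  have inv: "word_class (BS m n) [Inv 0] = inv s" "word_class (BS m n) [Inv 1] = inv t"
    using inv_word_class[OF wf_BS, of "[Gen _]" m n] by (auto simp: G_def s_def t_def)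
  have t: "bs_val G s t (bs_t \<epsilon> x) = bs_val G s t x \<otimes> (if \<epsilon> then t else inv t)" for \<epsilon> x
    using st prefix by (simp add: bs_val_def bs_t_def int_pow_mult int_pow_diff m_assoc split: prod.splits)
  have act: "bs_val G s t (bs_act m n l x) = bs_val G s t x \<otimes> word_class (BS m n) [l]"
    if "letter_gen l \<in> {0, 1}" for l x
    using that bs_val_bs_s[OF pos st rel, of _ x] t[of _ x] inv
    by (cases l) (auto simp: bs_act_def s_def t_def)
  show ?thesis
    using assms(6)
  proof (induction w arbitrary: x)
    case Nil
    then show ?case using val by (simp add: one_presented_group[symmetric] G_def[symmetric])
  next
    case (Cons l w)
    have "word_class (BS m n) (l # w) = word_class (BS m n) [l] \<otimes> word_class (BS m n) w"
      using mult_word_class[OF wf_BS, of "[l]" m n w] Cons.prems by (simp add: G_def)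
    moreover have "word_class (BS m n) [l] \<in> carrier G" "word_class (BS m n) w \<in> carrier G"
      using Cons.prems by (simp_all add: G_def)
    ultimately show ?case
      using Cons val by (simp add: act m_assoc)
  qed
qed

lemma word_eq_BS_iff:
  assumes "m > 0" "n > 0" "u \<in> words {0, 1}" "v \<in> words {0, 1}"
  shows "word_eq (BS m n) u v \<longleftrightarrow> fold (bs_act m n) u ([], 0) = fold (bs_act m n) v ([], 0)"
proof
  assume eq: "fold (bs_act m n) u ([], 0) = fold (bs_act m n) v ([], 0)"
  interpret group "presented_group (BS m n)" by (rule group_presented_group[OF wf_BS])
  have "bs_val (presented_group (BS m n)) s t ([], 0) = \<one>\<^bsub>presented_group (BS m n)\<^esub>" for s t
    by (simp add: bs_val_def)
  with eq bs_val_fold_bs_act[OF assms(1,2,3), of "([], 0)"] bs_val_fold_bs_act[OF assms(1,2,4), of "([], 0)"]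
  have "word_class (BS m n) u = word_class (BS m n) v"
    using assms(3,4) by simp
  then show "word_eq (BS m n) u v" using assms(3) by (simp add: word_class_eq_iff)
qed (use fold_bs_act_word_eq[OF assms(1,2)] in simp)

text \<open>States are coded with \<open>2 a + \<epsilon>\<close> for a pair \<open>(a, \<epsilon>)\<close> and with any pair \<open>(p, q)\<close> for
  \<open>N = p - q\<close>.\<close>

definition bs_decode :: "nat \<Rightarrow> bs_state" where
  "bs_decode c = (map (\<lambda>h. (h div 2, odd h)) (list_decode (pfst c)),
     int (pfst (psnd c)) - int (psnd (psnd c)))"

text \<open>For \<open>N = a - b\<close>, division stays within the naturals:
  \<open>a + (p - 1) * b = N + p * b\<close> has the remainder of \<open>N\<close> modulo
  \<open>p\<close> and a quotient \<open>k\<close> larger by \<open>b\<close>. So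
  \<open>q * (N div p)\<close> is coded by \<open>(q * k, q * b)\<close>.\<close>

definition bs_s_code :: "nat \<Rightarrow> nat \<Rightarrow> nat \<Rightarrow> nat \<Rightarrow> nat" where
  "bs_s_code p q \<epsilon> c =
     (if (pfst (psnd c) + (p - 1) * psnd (psnd c)) mod p = 0 \<and> pfst c \<noteq> 0 \<and> pfst (pfst c - 1) mod 2 \<noteq> \<epsilon>
      then prod_encode (psnd (pfst c - 1), prod_encode
        (pfst (pfst c - 1) div 2 + q * ((pfst (psnd c) + (p - 1) * psnd (psnd c)) div p), q * psnd (psnd c)))
      else prod_encode
        (Suc (prod_encode (2 * ((pfst (psnd c) + (p - 1) * psnd (psnd c)) mod p) + \<epsilon>, pfst c)),
         prod_encode (q * ((pfst (psnd c) + (p - 1) * psnd (psnd c)) div p), q * psnd (psnd c))))"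

definition bs_act_code :: "nat \<Rightarrow> nat \<Rightarrow> nat \<Rightarrow> nat \<Rightarrow> nat" where
  "bs_act_code m n l c =
     (if l = 0 then bs_s_code m n 1 c else if l = 1 then bs_s_code n m 0 c
      else if l mod 2 = 0 then prod_encode (pfst c, prod_encode (Suc (pfst (psnd c)), psnd (psnd c)))
      else prod_encode (pfst c, prod_encode (pfst (psnd c), Suc (psnd (psnd c)))))"

lemma computable_bs_act_code:
  "computable L \<Longrightarrow> computable F \<Longrightarrow> computable (\<lambda>x. bs_act_code m n (L x) (F x))"
  unfolding bs_act_code_def bs_s_code_def by (intro computable_intros)

lemma int_diff_div_mod:
  assumes "p > 0"
  shows "(int a - int b) div int p = int ((a + (p - 1) * b) div p) - int b"
    and "(int a - int b) mod int p = int ((a + (p - 1) * b) mod p)"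
proof -
  have "int (a + (p - 1) * b) = (int a - int b) + int b * int p"
    using assms by (cases p) (simp_all add: algebra_simps)
  moreover have "((int a - int b) + int b * int p) div int p = int b + (int a - int b) div int p"
    by (rule div_mult_self1) (use assms in simp)
  ultimately show "(int a - int b) div int p = int ((a + (p - 1) * b) div p) - int b"
    and "(int a - int b) mod int p = int ((a + (p - 1) * b) mod p)"
    by (simp_all only: zdiv_int zmod_int mod_mult_self1)
qed

lemma bs_decode_bs_s_code:
  assumes "m > 0" "n > 0"
  shows "bs_decode (bs_s_code (bs_in m n \<epsilon>) (bs_out m n \<epsilon>) (of_bool \<epsilon>) c) = bs_s m n \<epsilon> (bs_decode c)"
proof -
  define p where "p = bs_in m n \<epsilon>"
  define q where "q = bs_out m n \<epsilon>"
  obtain ys a b where c: "c = prod_encode (list_encode ys, prod_encode (a, b))"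
    by (metis list_decode_inverse prod.collapse prod_decode_inverse)
  have p: "p > 0" using assms by (simp add: p_def bs_in_def)
  define k where "k = (a + (p - 1) * b) div p"
  define r where "r = (a + (p - 1) * b) mod p"
  have k: "(int a - int b) div int p = int k - int b" and r: "(int a - int b) mod int p = int r"
    unfolding k_def r_def by (rule int_diff_div_mod[OF p])+
  have "bs_s_code p q (of_bool \<epsilon>) c =
     (if r = 0 \<and> list_encode ys \<noteq> 0 \<and> pfst (list_encode ys - 1) mod 2 \<noteq> of_bool \<epsilon>
      then prod_encode (psnd (list_encode ys - 1), prod_encode (pfst (list_encode ys - 1) div 2 + q * k, q * b))
      else prod_encode (Suc (prod_encode (2 * r + of_bool \<epsilon>, list_encode ys)), prod_encode (q * k, q * b)))"
    by (simp only: bs_s_code_def c prod_encode_inverse fst_conv snd_conv k_def r_def)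
  moreover have "bs_s m n \<epsilon> (xs, int a - int b) =
    (if int r = 0 \<and> xs \<noteq> [] \<and> snd (hd xs) \<noteq> \<epsilon>
     then (tl xs, int (fst (hd xs)) + int q * (int k - int b))
     else ((nat (int r), \<epsilon>) # xs, int q * (int k - int b)))" for xs
    by (simp only: bs_s_def Let_def prod.case p_def[symmetric] q_def[symmetric] k r)
  ultimately show ?thesis
    unfolding p_def[symmetric] q_def[symmetric]
    by (cases ys) (auto simp: c bs_decode_def right_diff_distrib odd_iff_mod_2_eq_one)
qed

lemma bs_decode_bs_act_code:
  assumes "m > 0" "n > 0"
  shows "bs_decode (bs_act_code m n (letter_code l) c) = bs_act m n l (bs_decode c)"
  using bs_decode_bs_s_code[OF assms, of True c] bs_decode_bs_s_code[OF assms, of False c]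
  by (cases l) (auto simp: bs_act_code_def bs_act_def bs_in_def, auto simp: bs_decode_def bs_t_def)

lemma bs_decode_fold_bs_act_code:
  assumes "m > 0" "n > 0"
  shows "bs_decode (fold (bs_act_code m n) (list_decode (word_code w)) c) = fold (bs_act m n) w (bs_decode c)"
  by (induction w arbitrary: c) (auto simp: word_code_def bs_decode_bs_act_code[OF assms])

text \<open>A difference has many codes, so its two components are compared with each other.\<close>

definition bs_trivial_code :: "nat \<Rightarrow> bool" where
  "bs_trivial_code c \<longleftrightarrow> pfst c = 0 \<and> pfst (psnd c) = psnd (psnd c)"

lemma bs_trivial_code_iff: "bs_trivial_code c \<longleftrightarrow> bs_decode c = ([], 0)"
proof -
  have "list_decode k = [] \<longleftrightarrow> k = 0" for k
    by (metis list_decode_inverse list_encode.simps(1) list_encode_inverse)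
  then show ?thesis by (simp add: bs_trivial_code_def bs_decode_def)
qed

lemma bs_decode_0: "bs_decode 0 = ([], 0)"
  by (simp add: bs_decode_def prod_decode_def prod_decode_aux.simps)

lemma decidable_bs_trivial_code [computable_intros]:
  "computable F \<Longrightarrow> decidable (\<lambda>x. bs_trivial_code (F x))"
  unfolding bs_trivial_code_def by (intro computable_intros)

lemma solvable_word_problem_BS:
  assumes "m > 0" "n > 0" shows "solvable_word_problem (BS m n)"
proof -
  have "decidable (\<lambda>x. bs_trivial_code (fold (bs_act_code m n) (list_decode x) 0))"
    by (intro computable_fold computable_bs_act_code computable_intros)
  then obtain D where D: "computes D
      (\<lambda>x. of_bool (bs_trivial_code (fold (bs_act_code m n) (list_decode x) 0)))"
    unfolding computable_def by blast
  have "evals D (word_code w) (if word_class (BS m n) w = \<one>\<^bsub>presented_group (BS m n)\<^esub> then 1 else 0)"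
    if "w \<in> words (gens (BS m n))" for w
    using that assms D word_eq_BS_iff[OF assms, of w "[]"]
    by (auto simp: computes_iff word_class_eq_one_iff bs_trivial_code_iff
        bs_decode_fold_bs_act_code bs_decode_0)
  then show ?thesis unfolding solvable_word_problem_def by blast
qed

section \<open>Substitution into coded words\<close>

lemma letter_code_eq_iff: "letter_code l = letter_code l' \<longleftrightarrow> l = l'"
  by (cases l; cases l'; simp; presburger)

lemma word_code_eq_iff: "word_code v = word_code w \<longleftrightarrow> v = w"
proof -
  have "inj letter_code" by (simp add: inj_def letter_code_eq_iff)
  then show ?thesis
    unfolding word_code_def by (metis inj_map_eq_map list_encode_inverse)
qed

lemma surj_letter_code: "\<exists>l. letter_code l = c"
proof (cases "even c")
  case True
  then have "letter_code (Gen (c div 2)) = c" by simp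
  then show ?thesis ..
next
  case False
  then have "letter_code (Inv (c div 2)) = c" by simp
  then show ?thesis ..
qed

lemma surj_word_code: "\<exists>w. word_code w = c"
proof -
  have "\<exists>w. map letter_code w = cs" for cs
  proof (induction cs)
    case (Cons c cs)
    then obtain w where "map letter_code w = cs" by blast
    moreover obtain l where "letter_code l = c" using surj_letter_code by blast
    ultimately have "map letter_code (l # w) = c # cs" by simp
    then show ?case by (rule exI)
  qed simp
  then obtain w where "map letter_code w = list_decode c" by blast
  then have "word_code w = c" by (simp add: word_code_def)
  then show ?thesis ..
qed

lemma letter_code_less_4_iff: "letter_code l < 4 \<longleftrightarrow> letter_gen l \<in> {0, 1}"
  by (cases l) auto

text \<open>Codes 0 to 3 are the letters over the two generators; any larger code sets the flag to 0
  for good.\<close>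

lemma words_code_iff:
  "fold (\<lambda>l b. if l < 4 then b else 0) (list_decode (word_code w)) (1::nat) = 1 \<longleftrightarrow> w \<in> words {0, 1}"
proof -
  have 0: "fold (\<lambda>l b. if l < 4 then b else 0) ls (0::nat) = 0" for ls :: "nat list"
    by (induction ls) auto
  show ?thesis
    using letter_code_less_4_iff by (induction w) (auto simp: word_code_def 0)
qed

text \<open>Exchanging \<open>2 * x\<close> and \<open>2 * x + 1\<close> inverts a letter; pushing
  onto the accumulator reverses the word.\<close>

definition word_inv_code :: "nat \<Rightarrow> nat" where
  "word_inv_code c = fold (\<lambda>l r. Suc (prod_encode (if l mod 2 = 0 then Suc l else l - 1, r))) (list_decode c) 0"

lemma computable_word_inv_code [computable_intros]:
  "computable F \<Longrightarrow> computable (\<lambda>x. word_inv_code (F x))"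
  unfolding word_inv_code_def by (intro computable_fold computable_intros)

lemma word_inv_code_word_code: "word_inv_code (word_code w) = word_code (word_inv w)"
proof -
  have "fold (\<lambda>l r. Suc (prod_encode (if l mod 2 = 0 then Suc l else l - 1, r))) (map letter_code w) (list_encode ls) =
      list_encode (map letter_code (word_inv w) @ ls)" for ls
  proof (induction w arbitrary: ls)
    case (Cons l w)
    show ?case using Cons.IH[of "letter_code (letter_inv l) # ls"] by (cases l) simp_all
  qed simp
  from this[of "[]"] show ?thesis by (simp add: word_inv_code_def word_code_def)
qed

lemma gen_map_code_pair: "gen_map_code {0, 1} \<phi> =
    Suc (prod_encode (word_code (\<phi> 0), Suc (prod_encode (word_code (\<phi> 1), 0))))"
  by (simp add: gen_map_code_def)

text \<open>Here \<open>y\<close> codes the list of \<phi>(0) and \<phi>(1); each \<open>- 1\<close>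
  strips the successor of a list constructor.\<close>

definition letter_subst_code :: "nat \<Rightarrow> nat \<Rightarrow> nat" where
  "letter_subst_code y l = (if l = 0 then pfst (y - 1) else if l = 1 then word_inv_code (pfst (y - 1))
     else if l = 2 then pfst (psnd (y - 1) - 1) else word_inv_code (pfst (psnd (y - 1) - 1)))"

lemma computable_letter_subst_code [computable_intros]:
  "computable F \<Longrightarrow> computable G \<Longrightarrow> computable (\<lambda>x. letter_subst_code (F x) (G x))"
  unfolding letter_subst_code_def by (intro computable_intros)

lemma letter_subst_code_letter_code:
  "letter_gen l \<in> {0, 1} \<Longrightarrow>
    letter_subst_code (gen_map_code {0, 1} \<phi>) (letter_code l) = word_code (letter_subst \<phi> l)"
  unfolding gen_map_code_pair
  by (cases l) (auto simp: letter_subst_code_def word_inv_code_word_code)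

text \<open>The body of the later unbounded search, hence zero stands for success. The word
  \<phi>(w) is never built: the images of its letters are fed to the action one by one.\<close>

lemma decidable_subst_test:
  assumes pos: "m > 0" "n > 0" and v: "v \<in> words {0, 1}"
  obtains T where "computable T"
    and "\<And>\<phi> w. \<phi> \<in> {0, 1} \<rightarrow> words {0, 1} \<Longrightarrow>
      T (prod_encode (gen_map_code {0, 1} \<phi>, word_code w)) = 0 \<longleftrightarrow>
      w \<in> words {0, 1} \<and> \<not> word_eq (BS m n) w [] \<and> word_eq (BS m n) (word_subst \<phi> w @ v) []"
proof -
  define run where "run x = fold (\<lambda>l c. fold (bs_act_code m n)
      (list_decode (letter_subst_code (pfst x) l)) c) (list_decode (psnd x)) 0" for x
  define P where "P x \<longleftrightarrow> fold (\<lambda>l b. if l < 4 then b else 0) (list_decode (psnd x)) (1::nat) = 1 \<and>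
      \<not> bs_trivial_code (fold (bs_act_code m n) (list_decode (psnd x)) 0) \<and>
      bs_trivial_code (fold (bs_act_code m n) (list_decode (word_code v)) (run x))" for x
  have run: "computable run"
    unfolding run_def by (intro computable_fold computable_bs_act_code computable_intros)
  have "computable (\<lambda>x. of_bool (\<not> P x))"
    unfolding P_def by (intro computable_fold computable_bs_act_code computable_intros run)
  moreover have "of_bool (\<not> P (prod_encode (gen_map_code {0, 1} \<phi>, word_code w))) = (0::nat) \<longleftrightarrow>
      w \<in> words {0, 1} \<and> \<not> word_eq (BS m n) w [] \<and> word_eq (BS m n) (word_subst \<phi> w @ v) []"
    if \<phi>: "\<phi> \<in> {0, 1} \<rightarrow> words {0, 1}" for \<phi> w
  proof (cases "w \<in> words {0, 1}")
    case True
    have "bs_decode (fold (\<lambda>l c. fold (bs_act_code m n)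
        (list_decode (letter_subst_code (gen_map_code {0, 1} \<phi>) l)) c) (map letter_code w) c) =
      fold (bs_act m n) (word_subst \<phi> w) (bs_decode c)" for c
      using True
      by (induction w arbitrary: c)
        (simp_all add: letter_subst_code_letter_code bs_decode_fold_bs_act_code[OF pos] del: One_nat_def)
    from this[of 0] have "bs_decode (run (prod_encode (gen_map_code {0, 1} \<phi>, word_code w))) =
        fold (bs_act m n) (word_subst \<phi> w) ([], 0)"
      by (simp add: run_def word_code_def bs_decode_0)
    then show ?thesis
      using True v word_subst_in_words[OF \<phi> True] word_eq_BS_iff[OF pos, of _ "[]"] words_code_iff[of w]
      by (simp add: P_def bs_trivial_code_iff bs_decode_fold_bs_act_code[OF pos] bs_decode_0)
  next
    case False
    then show ?thesis using words_code_iff[of w] by (simp add: P_def)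
  qed
  ultimately show thesis using that by blast
qed

section \<open>A proper quotient of BS(2,3) isomorphic to BS(2,3)\<close>

text \<open>The commutator of \<open>s\<^sup>-\<^sup>1 t s\<close> and \<open>t\<close>.\<close>

definition bs_commutator :: "nat word" where
  "bs_commutator = [Inv 0, Gen 1, Gen 0, Gen 1, Inv 0, Inv 1, Gen 0, Inv 1]"

definition BS23_quotient :: "nat presentation" where
  "BS23_quotient = Presentation {0, 1} (insert bs_commutator (rels (BS 2 3)))"

lemmas bs_eval = bs_act_def bs_s_def bs_t_def bs_in_def word_inv_def

text \<open>The exponents of \<open>t\<close> between opposite powers of \<open>s\<close> are 1, 1
  and -1, divisible by neither 2 nor 3, so nothing cancels in the sense of Britton.\<close>

lemma bs_commutator_nontrivial: "\<not> word_eq (BS 2 3) bs_commutator []"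
  by (subst word_eq_BS_iff) (simp_all add: bs_commutator_def bs_eval)

lemma bs_commutator_in_words: "bs_commutator \<in> words {0, 1}"
  by (simp add: bs_commutator_def)

lemma wf_BS23_quotient: "wf_presentation BS23_quotient"
  by (simp add: wf_presentation_def BS23_quotient_def bs_commutator_def rels_BS)

lemma word_eq_quotientI: "word_eq (BS 2 3) u v \<Longrightarrow> word_eq BS23_quotient u v"
  by (erule word_eq_mono[rotated 2]) (auto simp: BS23_quotient_def)

lemma word_eq_quotient_commutator: "word_eq BS23_quotient bs_commutator []"
  using word_eq.relator[of "[]" BS23_quotient "[]" bs_commutator] by (simp add: BS23_quotient_def)

lemma BS23_iso_quotient: "presented_group (BS 2 3) \<cong> presented_group BS23_quotient"
proof -
  let ?Q = BS23_quotient and ?k = bs_commutator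
  \<comment> \<open>Chosen so that \<open>t \<mapsto> t^2\<close> sends it to
    \<open>s^-1 t^2 s t^-2 = t\<close>.\<close>
  define b :: "nat word" where "b = [Inv 0, Gen 1, Gen 0, Inv 1]"
  define \<phi> :: "nat \<Rightarrow> nat word" where "\<phi> = (\<lambda>x. if x = 0 then [Gen 0] else b)"
  define \<chi> :: "nat \<Rightarrow> nat word" where "\<chi> = (\<lambda>x. if x = 0 then [Gen 0] else [Gen 1, Gen 1])"
  have gensQ: "gens ?Q = {0, 1}" by (simp add: BS23_quotient_def)
  have b: "b \<in> words {0, 1}" by (simp add: b_def)
  text \<open>Modulo the commutator, \<open>b\<^sup>2 = s\<^sup>-\<^sup>1 t\<^sup>2 s t\<^sup>-\<^sup>2 = t\<close>, so that \<open>t \<mapsto> b\<close> inverts \<open>t \<mapsto> t\<^sup>2\<close>.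
    Each such identity becomes, once conjugates of the commutator are inserted, an identity in
    \<open>BS 2 3\<close>, where it is decided by evaluating the action.\<close>
  have kill: "word_eq ?Q (u @ ?k @ v) (u @ v)" if "u \<in> words {0, 1}" "v \<in> words {0, 1}" for u v
    using word_eq_context[OF word_eq_quotient_commutator, of u v] that by (simp add: gensQ)
  have P_eq: "word_eq (BS 2 3) u v"
    if "u \<in> words {0, 1}" "v \<in> words {0, 1}" "fold (bs_act 2 3) u ([], 0) = fold (bs_act 2 3) v ([], 0)" for u v
    using that by (simp add: word_eq_BS_iff)
  note [trans] = word_eq.trans
  note Q_eq = word_eq_quotientI[OF P_eq]
  show ?thesis
  proof (rule presented_group_isoI[of _ _ \<phi> \<chi>])
    show "wf_presentation (BS 2 3)" "wf_presentation ?Q" by (rule wf_BS wf_BS23_quotient)+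
    show "\<phi> \<in> gens (BS 2 3) \<rightarrow> words (gens ?Q)" "\<chi> \<in> gens ?Q \<rightarrow> words (gens (BS 2 3))"
      by (auto simp: \<phi>_def \<chi>_def b_def gensQ)
    \<comment> \<open>The relator goes to \<open>s^-1 t^4 s t^-6\<close>, and the commutator to that
      of \<open>s^-1 t^2 s = t^3\<close> and \<open>t^2\<close>; both are trivial.\<close>
    show "word_eq (BS 2 3) (word_subst \<chi> r) []" if "r \<in> rels ?Q" for r
      using that by (intro P_eq) (auto simp: BS23_quotient_def rels_BS bs_commutator_def \<chi>_def bs_eval numeral_eq_Suc)
    show "word_eq (BS 2 3) (word_subst \<chi> (\<phi> x)) [Gen x]" if "x \<in> gens (BS 2 3)" for x
      using that by (intro P_eq) (auto simp: \<phi>_def b_def \<chi>_def bs_eval)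
    have bb: "word_eq ?Q (b @ b) [Gen 1]"
    proof -
      \<comment> \<open>With \<open>c = s^-1 t s\<close>, so that \<open>c^2 = t^3\<close>, both
        sides are \<open>c t^-1 c t^-1\<close>.\<close>
      have "word_eq ?Q (b @ b) (b @ ?k @ word_inv b @ [Gen 1])"
        by (rule Q_eq) (simp_all add: b_def bs_commutator_def bs_eval)
      also have "word_eq ?Q \<dots> (b @ word_inv b @ [Gen 1])"
        using kill[of b "word_inv b @ [Gen 1]"] b by simp
      also have "word_eq ?Q \<dots> [Gen 1]"
        by (rule Q_eq) (simp_all add: b_def bs_eval)
      finally show ?thesis .
    qed
    then show "word_eq ?Q (word_subst \<phi> (\<chi> y)) [Gen y]" if "y \<in> gens ?Q" for y
      using that by (auto simp: \<phi>_def \<chi>_def gensQ intro: word_eq.refl)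
    show "word_eq ?Q (word_subst \<phi> r) []" if "r \<in> rels (BS 2 3)" for r
    proof -
      define R where "R = [Inv 0] @ b @ b @ [Gen 0] @ word_inv b @ word_inv b @ word_inv b"
      have R: "R \<in> words {0, 1}" "word_subst \<phi> r = R"
        using that b by (auto simp: R_def \<phi>_def rels_BS numeral_eq_Suc)
      \<comment> \<open>The identity \<open>b k b^-1 = b^2 t^-1\<close> of \<open>BS 2 3\<close>
        serves twice: inserted behind \<open>R\<close>, it turns \<open>b^-3\<close> into
        \<open>b^-1 t^-1\<close>, and the factor \<open>b^2\<close> of \<open>R\<close> becomes
        \<open>b k b^-1 t\<close>. Deleting \<open>k\<close> leaves
        \<open>s^-1 t s b^-1 t^-1\<close>, which is \<open>k\<close> itself.\<close>
      have "word_eq ?Q R (R @ b @ word_inv b)"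
        by (rule Q_eq) (simp_all add: R_def b_def bs_eval)
      also have "word_eq ?Q \<dots> (R @ b @ ?k @ word_inv b)"
        using word_eq.sym[OF kill[of "R @ b" "word_inv b"]] b R by simp
      also have "word_eq ?Q \<dots> ([Inv 0] @ b @ ?k @ word_inv b @ [Gen 1, Gen 0] @ word_inv b @ [Inv 1])"
        by (rule Q_eq) (simp_all add: R_def b_def bs_commutator_def bs_eval)
      also have "word_eq ?Q \<dots> ([Inv 0] @ b @ word_inv b @ [Gen 1, Gen 0] @ word_inv b @ [Inv 1])"
        using kill[of "[Inv 0] @ b" "word_inv b @ [Gen 1, Gen 0] @ word_inv b @ [Inv 1]"] b by simp
      also have "word_eq ?Q \<dots> ?k"
        by (rule Q_eq) (simp_all add: b_def bs_commutator_def bs_eval)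
      also have "word_eq ?Q \<dots> []" by (rule word_eq_quotient_commutator)
      finally show ?thesis by (simp only: R)
    qed
  qed
qed

section \<open>The diagonal argument\<close>

theorem lemma4p2:
  "\<exists>P. P = BS 2 3 \<and> finite_presentation P \<and> solvable_word_problem P \<and>
     \<not> (\<exists>A. \<forall>Y e.
          is_recursive_presentation Y e \<and>
          presented_group P \<cong> presented_group (recursive_presentation Y e) \<longrightarrow>
          (\<exists>\<phi> \<in> gens P \<rightarrow> words Y.
             evals A (recursive_presentation_code Y e) (gen_map_code (gens P) \<phi>) \<and>
             extends_to_iso P (recursive_presentation Y e) \<phi>))"
proof (intro exI conjI notI)
  let ?P = "BS 2 3" and ?k = bs_commutator
  show "finite_presentation ?P" by (rule finite_presentation_BS)
  show "solvable_word_problem ?P" by (rule solvable_word_problem_BS) simp_all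
  assume "\<exists>A. \<forall>Y e. is_recursive_presentation Y e \<and>
      presented_group ?P \<cong> presented_group (recursive_presentation Y e) \<longrightarrow>
      (\<exists>\<phi> \<in> gens ?P \<rightarrow> words Y. evals A (recursive_presentation_code Y e) (gen_map_code (gens ?P) \<phi>) \<and>
         extends_to_iso ?P (recursive_presentation Y e) \<phi>)"
  then obtain A where A: "\<And>Y e. is_recursive_presentation Y e \<Longrightarrow>
      presented_group ?P \<cong> presented_group (recursive_presentation Y e) \<Longrightarrow>
      \<exists>\<phi> \<in> {0, 1} \<rightarrow> words Y. evals A (recursive_presentation_code Y e) (gen_map_code {0, 1} \<phi>) \<and>
         extends_to_iso ?P (recursive_presentation Y e) \<phi>"
    unfolding gens_BS by blast
  have k: "?k \<in> words {0, 1}" by (rule bs_commutator_in_words)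
  obtain r where r: "rels ?P = {r}" using rels_BS by blast
  obtain T where "computable T" and T: "\<And>\<phi> w. \<phi> \<in> {0, 1} \<rightarrow> words {0, 1} \<Longrightarrow>
      T (prod_encode (gen_map_code {0, 1} \<phi>, word_code w)) = 0 \<longleftrightarrow>
      w \<in> words {0, 1} \<and> \<not> word_eq ?P w [] \<and> word_eq ?P (word_subst \<phi> w @ word_inv ?k) []"
    by (rule decidable_subst_test[of 2 3 "word_inv ?k"]) (use k in auto)
  then obtain f where f: "computes f T" unfolding computable_def by blast
  \<comment> \<open>Given \<open>recf_code e\<close> as first component, \<open>S\<close> runs
    \<open>A\<close> on the presentation enumerated by \<open>e\<close> and searches for a word that
    the answer sends to \<open>?k\<close>; what counts is whether it halts.\<close>
  define S where "S = Comp (Mu f) (Comp A (PairF (Const (set_encode {0, 1})) Proj1))"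
  \<comment> \<open>Input 0 yields the relator before the algorithm is consulted; a positive input
    yields \<open>?k\<close> once \<open>S\<close> has halted and diverges otherwise.\<close>
  define E where "E = PrimRec (Const (word_code r)) (Comp (Const (word_code ?k)) S)"
  obtain e where e: "\<And>i k. evals e i k \<longleftrightarrow> evals E (prod_encode (recf_code e, i)) k"
    using recursion_theorem[of E] by blast
  define Q where "Q = recursive_presentation {0, 1} e"
  define c where "c = recursive_presentation_code {0, 1} e"
  have "computes (PairF (Const (set_encode {0, 1})) Proj1) (\<lambda>z. prod_encode (set_encode {0, 1}, pfst z))"
    by (intro computes_PairF computes_Const computes_Proj1)
  then have S: "evals S (prod_encode (recf_code e, z)) x \<longleftrightarrow> (\<exists>y. evals A c y \<and> evals (Mu f) y x)" for z x
    by (auto simp: S_def evals_Comp_iff computes_iff c_def recursive_presentation_code_def)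
  define halts where "halts \<longleftrightarrow> (\<exists>y x. evals A c y \<and> evals (Mu f) y x)"
  have E_0: "evals E (prod_encode (recf_code e, 0)) x \<longleftrightarrow> x = word_code r" for x
    by (simp add: E_def evals_PrimRec_0_iff computes_iff[OF computes_Const])
  have E_Suc: "evals E (prod_encode (recf_code e, Suc i)) x \<longleftrightarrow> x = word_code ?k \<and> halts" for x i
  proof (induction i arbitrary: x)
    case 0
    then show ?case using E_0[unfolded E_def]
      by (auto simp: E_def evals_PrimRec_Suc_iff evals_Comp_iff S halts_def computes_iff[OF computes_Const])
  next
    case (Suc i)
    then show ?case using E_0[unfolded E_def]
      by (auto simp: E_def evals_PrimRec_Suc_iff[of _ _ _ "Suc i"] evals_Comp_iff S halts_def computes_iff[OF computes_Const])
  qed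
  have enum: "(\<exists>i. evals e i x) \<longleftrightarrow> x = word_code r \<or> x = word_code ?k \<and> halts" for x
    unfolding e using E_0 E_Suc by (metis not0_implies_Suc)
  then have rels_Q: "rels Q = (if halts then insert ?k (rels ?P) else rels ?P)"
    by (auto simp: Q_def recursive_presentation_def word_code_eq_iff r)
  have gens_Q: "gens Q = {0, 1}" by (simp add: Q_def recursive_presentation_def)
  have Q: "Q = (if halts then BS23_quotient else ?P)"
    using rels_Q gens_Q by (cases Q) (simp add: BS23_quotient_def, simp add: BS_def)
  have wf_Q: "wf_presentation Q" by (simp add: Q wf_BS wf_BS23_quotient)
  have "r \<in> words {0, 1}" using wf_BS[of 2 3] r by (simp add: wf_presentation_def)
  then have "is_recursive_presentation {0, 1} e"
    using enum k by (fastforce simp: is_recursive_presentation_def)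
  \<comment> \<open>Whether or not \<open>halts\<close> holds, the group is isomorphic to that of
    \<open>?P\<close>, so the algorithm is bound to answer.\<close>
  moreover have "presented_group ?P \<cong> presented_group Q"
    using BS23_iso_quotient iso_refl by (simp add: Q)
  ultimately obtain \<phi> where \<phi>: "\<phi> \<in> {0, 1} \<rightarrow> words {0, 1}"
    and A\<phi>: "evals A c (gen_map_code {0, 1} \<phi>)" and iso: "extends_to_iso ?P Q \<phi>"
    using A unfolding Q_def c_def by blast
  from iso obtain h where h: "h \<in> hom (presented_group ?P) (presented_group Q)"
    and bij: "bij_betw h (carrier (presented_group ?P)) (carrier (presented_group Q))"
    and gens: "\<And>x. x \<in> {0, 1} \<Longrightarrow> h (word_class ?P [Gen x]) = word_class Q (\<phi> x)"
    unfolding extends_to_iso_def gens_BS iso_def by blast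
  have h: "h (word_class ?P w) = word_class Q (word_subst \<phi> w)" if "w \<in> words {0, 1}" for w
    using hom_word_class[OF wf_BS wf_Q _ h] \<phi> gens that by (simp add: gens_Q)
  have \<phi>w: "word_subst \<phi> w \<in> words {0, 1}" if "w \<in> words {0, 1}" for w
    by (rule word_subst_in_words[OF \<phi> that])
  have inj: "word_eq ?P w []" if w: "w \<in> words {0, 1}" "word_eq Q (word_subst \<phi> w) []" for w
  proof -
    have "h (word_class ?P w) = h (word_class ?P [])"
      using w \<phi>w by (simp add: h word_class_eq_iff gens_Q)
    then have "word_class ?P w = word_class ?P []"
      using bij w by (auto simp: bij_betw_def inj_on_eq_iff)
    then show ?thesis using w by (simp add: word_class_eq_iff)
  qed
  \<comment> \<open>Programs are deterministic, so the answer examined by the machine is this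
    \<phi>; every number codes a word, so the search runs over all words.\<close>
  have halts_iff: "halts \<longleftrightarrow> (\<exists>w \<in> words {0, 1}. \<not> word_eq ?P w [] \<and>
      word_eq ?P (word_subst \<phi> w @ word_inv ?k) [])"
  proof -
    have "halts \<longleftrightarrow> (\<exists>x. evals (Mu f) (gen_map_code {0, 1} \<phi>) x)"
      using A\<phi> evals_functional unfolding halts_def by blast
    also have "\<dots> \<longleftrightarrow> (\<exists>x. T (prod_encode (gen_map_code {0, 1} \<phi>, x)) = 0)"
      by (rule evals_Mu_iff[OF f])
    also have "\<dots> \<longleftrightarrow> (\<exists>w. T (prod_encode (gen_map_code {0, 1} \<phi>, word_code w)) = 0)"
      using surj_word_code by metis
    finally show ?thesis using T[OF \<phi>] by blast
  qed
  have kk: "word_eq ?P (?k @ word_inv ?k) []" by (rule word_eq_right_inv) (use k in simp)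
  show False
  proof (cases halts)
    case True
    then obtain w where w: "w \<in> words {0, 1}" "\<not> word_eq ?P w []"
      "word_eq ?P (word_subst \<phi> w @ word_inv ?k) []" using halts_iff by blast
    have Q: "Q = BS23_quotient" using True by (simp add: Q)
    note [trans] = word_eq.trans
    \<comment> \<open>In the quotient \<open>?k\<close> is trivial, hence so is the image of the
      nontrivial \<open>w\<close>, against injectivity.\<close>
    have "word_eq Q (word_subst \<phi> w @ []) (word_subst \<phi> w @ word_inv ?k)"
      using word_eq_append[OF wf_Q word_eq.refl word_eq.sym[OF word_eq_inv[OF wf_Q]], of "word_subst \<phi> w" ?k "[]"]
        word_eq_quotient_commutator \<phi>w[OF w(1)] by (simp add: Q gens_Q[unfolded Q])
    also have "word_eq Q (word_subst \<phi> w @ word_inv ?k) []"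
      using word_eq_quotientI[OF w(3)] by (simp add: Q)
    finally show False using inj[OF w(1)] w(2) by simp
  next
    case False
    then have Q: "Q = ?P" by (simp add: Q)
    \<comment> \<open>Surjectivity yields a preimage of \<open>?k\<close>, nontrivial because
      \<open>?k\<close> is; the search would have found it.\<close>
    have "word_class Q ?k \<in> h ` carrier (presented_group ?P)"
      using bij k gens_Q by (simp add: bij_betw_def)
    then obtain w where w: "w \<in> words {0, 1}" "word_class Q ?k = word_class Q (word_subst \<phi> w)"
      using h by (auto simp: carrier_presented_group)
    then have wk: "word_eq ?P ?k (word_subst \<phi> w)"
      using k by (simp add: word_class_eq_iff Q)
    have "\<not> word_eq ?P w []"
    proof
      assume "word_eq ?P w []"
      then have "word_class ?P w = word_class ?P []"
        using w by (simp add: word_class_eq_iff)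
      then have "h (word_class ?P w) = h (word_class ?P [])" by simp
      then have "word_eq ?P (word_subst \<phi> w) []"
        using w \<phi>w by (simp add: h word_class_eq_iff Q)
      with wk show False using bs_commutator_nontrivial word_eq.trans by blast
    qed
    moreover have "word_eq ?P (word_subst \<phi> w @ word_inv ?k) []"
      using word_eq_context[OF word_eq.sym[OF wk], of "[]" "word_inv ?k"] kk k
      by (auto intro: word_eq.trans)
    ultimately show False using w False halts_iff by blast
  qed
qed simp

end
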